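(* Let $H\in\mathbb{R}^{2n\times 2n}$ be a nonsingular Hamiltonian matrix, let $k\ge1$ with $2k\le n$, and let $u_1\in\mathbb{R}^{2n}$ with $\|u_1\|_2=1$, $\dim\mathcal{K}_{2k}(H,u_1)=2k$ and $\dim\mathcal{K}_{2k}(H^{-1},H^{-1}u_1)=2k$. Suppose that the HEKS procedure (described in the context) started with $u_1$ does not break down up to the construction of $S_{2k}=[\,y_k\ \cdots\ y_1\ u_1\ \cdots\ u_k\mid x_k\ \cdots\ x_1\ v_1\ \cdots\ v_k\,]$. Then $S_{2k}^TJ_nS_{2k}=J_{2k}$, $\operatorname{range}\{S_{2k}\}=\mathcal{K}_{2k}(H,u_1)+\mathcal{K}_{2k}(H^{-1},H^{-1}u_1)$, and the columns of $S_{2k}$ satisfy the following short recurrences. (i) For $1\le j\le k$: $v_j=Hu_j/\vartheta_j$ with $\vartheta_j=u_j^TJ_nHu_j$, and $y_j=H^{-1}x_j/\big((H^{-1}x_j)^TJ_nx_j\big)$. (ii) $x_1=w/\|w\|_2$ with $w=H^{-1}u_1-f_{11}v_1$, where $f_{11}=u_1^TJ_nH^{-1}u_1$. (iii) For $2\le j\le k$: $u_j=w/\|w\|_2$ with $$w=Hv_{j-1}-\gamma_{j-1}y_{j-1}-\mu_{j-1}y_{j-2}-\beta_{j-1}u_{j-2}-\alpha_{j-1}u_{j-1},$$ where $\alpha_i=-v_i^TJ_nHv_i$ and $\gamma_i=-x_i^TJ_nHv_i$ for $i\ge1$, $\beta_i=-v_i^TJ_nHv_{i-1}$ and $\mu_i=-x_{i-1}^TJ_nHv_i$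 for $i\ge2$, and $\beta_1=\mu_1=0$, $y_0=u_0=0$. (iv) For $2\le j\le k$: $x_j=w/\|w\|_2$ with $$w=H^{-1}y_{j-1}-e_{j-1,j-1}x_{j-1}-e_{j-2,j-1}x_{j-2}-g_{j-1,j-1}v_{j-1}-g_{j-1,j}v_j,$$ where $e_{i,i}=y_i^TJ_nH^{-1}y_i$, $g_{i,i}=y_i^TJ_nH^{-1}u_i$ and $g_{i,i+1}=y_i^TJ_nH^{-1}u_{i+1}$ for $i\ge1$, $e_{i-1,i}=y_i^TJ_nH^{-1}y_{i-1}$ for $i\ge2$, and $e_{0,1}=0$, $x_0=0$.
   Context: Notation: $J_m=\begin{bmatrix}0&I_m\\-I_m&0\end{bmatrix}\in\mathbb{R}^{2m\times 2m}$. A matrix $H\in\mathbb{R}^{2n\times2n}$ is Hamiltonian if $J_nH=(J_nH)^T$. $\mathcal{K}_m(A,b)=\operatorname{span}\{b,Ab,\ldots,A^{m-1}b\}$, and $\operatorname{range}$ is the column span. HEKS procedure. Given $u_1$ with $\|u_1\|_2=1$, matrices $S_1,S_2,\ldots$ are built, where $S_m\in\mathbb{R}^{2n\times 2m}$ and $S_{2k}=[\,y_k\ \cdots\ y_1\ u_1\ \cdots\ u_k\mid x_k\ \cdots\ x_1\ v_1\ \cdots\ v_k\,]$, $S_{2k+1}=[\,y_k\ \cdots\ y_1\ u_1\ \cdots\ u_{k+1}\mid x_k\ \cdots\ x_1\ v_1\ \cdots\ v_{k+1}\,]$. Put $P_m=I-S_mJ_m^TS_m^TJ_n$ ($J$-orthogonalization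 against the columns of $S_m$). (1) $v_1=Hu_1/(u_1^TJ_nHu_1)$, which gives $S_1=[u_1\mid v_1]$. (2) From $S_1$ to $S_2$: $w_x=P_1H^{-1}u_1$, $x_1=w_x/\|w_x\|_2$, $w_y=P_1H^{-1}x_1$, $y_1=w_y/(w_y^TJ_nx_1)$. (3) From $S_{2k}$ to $S_{2k+1}$, $k\ge1$: $w_u=P_{2k}Hv_k$, $u_{k+1}=w_u/\|w_u\|_2$, $w_v=P_{2k}Hu_{k+1}$, $v_{k+1}=w_v/(u_{k+1}^TJ_nw_v)$. (4) From $S_{2k+1}$ to $S_{2k+2}$, $k\ge1$: $w_x=P_{2k+1}H^{-1}y_k$, $x_{k+1}=w_x/\|w_x\|_2$, $w_y=P_{2k+1}H^{-1}x_{k+1}$, $y_{k+1}=w_y/(w_y^TJ_nx_{k+1})$. The procedure does not break down up to $S_m$ if every number divided by in the steps needed to construct $S_m$ is nonzero. *)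

theory Defs
  imports
    "Jordan_Normal_Form.VS_Connect"
    "Jordan_Normal_Form.Gauss_Jordan_Elimination"
begin

definition J_mat :: "nat \<Rightarrow> real mat" where
  "J_mat m = four_block_mat (0\<^sub>m m m) (1\<^sub>m m) (- 1\<^sub>m m) (0\<^sub>m m m)"

(* a^T J_n b *)
definition J_form :: "nat \<Rightarrow> real vec \<Rightarrow> real vec \<Rightarrow> real" where
  "J_form n a b = a \<bullet> (J_mat n *\<^sub>v b)"

definition hamiltonian_mat :: "nat \<Rightarrow> real mat \<Rightarrow> bool" where
  "hamiltonian_mat n H \<longleftrightarrow>
     H \<in> carrier_mat (2 * n) (2 * n) \<and> J_mat n * H = (J_mat n * H)\<^sup>T"

definition norm2 :: "real vec \<Rightarrow> real" where
  "norm2 w = sqrt (w \<bullet> w)"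

(* meaningful for nonsingular A only: mat_inverse is None otherwise *)
definition inv_mat :: "real mat \<Rightarrow> real mat" where
  "inv_mat A = the (mat_inverse A)"

(* Span and dimension are those of the AFP entry VectorSpace, for the coordinate space R^N. *)

definition krylov :: "nat \<Rightarrow> real mat \<Rightarrow> real vec \<Rightarrow> nat \<Rightarrow> real vec set" where
  "krylov N A b m =
     LinearCombinations.module.span class_ring (module_vec TYPE(real) N)
       ((\<lambda>i. (A ^\<^sub>m i) *\<^sub>v b) ` {..<m})"

definition subspace_dim :: "nat \<Rightarrow> real vec set \<Rightarrow> nat" where
  "subspace_dim N W =
     vectorspace.dim class_ring ((module_vec TYPE(real) N)\<lparr>carrier := W\<rparr>)"

definition col_range :: "real mat \<Rightarrow> real vec set" where
  "col_range S =
     LinearCombinations.module.span class_ring (module_vec TYPE(real) (dim_row S)) (set (cols S))"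

definition subspace_sum :: "real vec set \<Rightarrow> real vec set \<Rightarrow> real vec set" where
  "subspace_sum U W = {p + q | p q. p \<in> U \<and> q \<in> W}"

(* With a = m div 2 and b = (m + 1) div 2 this is
   S_m = [ y_a ... y_1 u_1 ... u_b | x_a ... x_1 v_1 ... v_b ],
   i.e. a = b = k for m = 2k, and a = k, b = k + 1 for m = 2k + 1 (so S_1 = [ u_1 | v_1 ]). *)
definition heks_S ::
  "nat \<Rightarrow> (nat \<Rightarrow> real vec) \<Rightarrow> (nat \<Rightarrow> real vec) \<Rightarrow> (nat \<Rightarrow> real vec) \<Rightarrow> (nat \<Rightarrow> real vec)
   \<Rightarrow> nat \<Rightarrow> real mat" where
  "heks_S n u v x y m = (let a = m div 2; b = (m + 1) div 2 in
     mat_of_cols (2 * n)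
       (map y (rev [1..<Suc a]) @ map u [1..<Suc b] @ map x (rev [1..<Suc a]) @ map v [1..<Suc b]))"

definition heks_P ::
  "nat \<Rightarrow> (nat \<Rightarrow> real vec) \<Rightarrow> (nat \<Rightarrow> real vec) \<Rightarrow> (nat \<Rightarrow> real vec) \<Rightarrow> (nat \<Rightarrow> real vec)
   \<Rightarrow> nat \<Rightarrow> real mat" where
  "heks_P n u v x y m = (let S = heks_S n u v x y m in
     1\<^sub>m (2 * n) - S * (J_mat m)\<^sup>T * S\<^sup>T * J_mat n)"

(* heks_run n H u1 u v x y m: the vectors u_i, v_i, x_i, y_i (i >= 1) occurring in S_m are those
   produced by the procedure started with u1, and every number divided by in the steps up to the
   construction of S_m is nonzero.  Entries of the sequences that do not occur in S_m are
   unconstrained.  The conjuncts are the steps to S_1, from S_1 to S_2, from S_{2k} to S_{2k+1}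
   and from S_{2k+1} to S_{2k+2}. *)
definition heks_run ::
  "nat \<Rightarrow> real mat \<Rightarrow> real vec
   \<Rightarrow> (nat \<Rightarrow> real vec) \<Rightarrow> (nat \<Rightarrow> real vec) \<Rightarrow> (nat \<Rightarrow> real vec) \<Rightarrow> (nat \<Rightarrow> real vec)
   \<Rightarrow> nat \<Rightarrow> bool" where
  "heks_run n H u1 u v x y m \<longleftrightarrow> (let K = inv_mat H; P = heks_P n u v x y in
     (1 \<le> m \<longrightarrow>
        u 1 = u1 \<and>
        J_form n (u 1) (H *\<^sub>v u 1) \<noteq> 0 \<and>
        v 1 = (1 / J_form n (u 1) (H *\<^sub>v u 1)) \<cdot>\<^sub>v (H *\<^sub>v u 1)) \<and>
     (2 \<le> m \<longrightarrow>
        (let wx = P 1 *\<^sub>v (K *\<^sub>v u 1); wy = P 1 *\<^sub>v (K *\<^sub>v x 1) in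
           norm2 wx \<noteq> 0 \<and> x 1 = (1 / norm2 wx) \<cdot>\<^sub>v wx \<and>
           J_form n wy (x 1) \<noteq> 0 \<and> y 1 = (1 / J_form n wy (x 1)) \<cdot>\<^sub>v wy)) \<and>
     (\<forall>k\<ge>1. 2 * k + 1 \<le> m \<longrightarrow>
        (let wu = P (2 * k) *\<^sub>v (H *\<^sub>v v k); wv = P (2 * k) *\<^sub>v (H *\<^sub>v u (k + 1)) in
           norm2 wu \<noteq> 0 \<and> u (k + 1) = (1 / norm2 wu) \<cdot>\<^sub>v wu \<and>
           J_form n (u (k + 1)) wv \<noteq> 0 \<and>
           v (k + 1) = (1 / J_form n (u (k + 1)) wv) \<cdot>\<^sub>v wv)) \<and>
     (\<forall>k\<ge>1. 2 * k + 2 \<le> m \<longrightarrow>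
        (let wx = P (2 * k + 1) *\<^sub>v (K *\<^sub>v y k); wy = P (2 * k + 1) *\<^sub>v (K *\<^sub>v x (k + 1)) in
           norm2 wx \<noteq> 0 \<and> x (k + 1) = (1 / norm2 wx) \<cdot>\<^sub>v wx \<and>
           J_form n wy (x (k + 1)) \<noteq> 0 \<and>
           y (k + 1) = (1 / J_form n wy (x (k + 1))) \<cdot>\<^sub>v wy)))"

end

(* Listed in the order in which the procedure produces them, the pairs (u_1, v_1), (x_1, y_1),
   (u_2, v_2), (x_2, y_2), ... form one sequence (p_m, t_m), where odd steps use H and even steps
   use its inverse; both matrices are skew-adjoint for the form a^T J b.  The J-orthogonality of
   the pairs is immediate from the projections.  By induction on m the matrix A of step m + 1 maps
   the span C_m of the first m pairs into C_m + <p_{m+1}>: on C_{m-1} and on p_m, t_m this follows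
   from the two preceding steps, because A also is the matrix of step m - 1 and inverts that of
   step m.  As p_{m+1} is J-orthogonal to C_m + <p_{m+1}>, skew-adjointness makes A p_{m+1}
   J-orthogonal to C_m, so its projection is trivial and t_{m+1} is a multiple of A p_{m+1}.
   The same inclusion kills all but four of the coefficients in the projection of A t_{m-1}, and
   applied to the powers of H and of its inverse it shows that the Krylov spaces lie in the span
   of the columns. *)

theory Submission
  imports Defs
begin

text \<open>The matrix I - S J^T S^T J is a J-orthogonal projection only once S^T J S = J is known,
  and that relation itself comes from earlier projections. The locale therefore characterises
  \<open>P m\<close> conditionally: given J-orthogonality of the first m pairs, the projection of w
  is the unique z that is J-orthogonal to them and differs from w by an element of their span.
  Projections are then computed by exhibiting z, and the columns of S return only when the locale is
  instantiated. In the column order y pairs with x, but u with v, so the form of p_m with t_m is 1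
  for odd m and -1 for even m; hence \<open>alt_sign\<close>. One generator of C_m is not controlled
  by earlier steps: the image of t_{m-1} under the matrix of step m + 1 is the vector that this step
  projects. It lies in C_m + <p_{m+1}> because p_{m+1} is its normalised projection; this is why the
  extra vector has to be allowed. The range formula comes from two inclusions between generators.
  For the one not in the overview, each new pair widens a window of powers of H applied to u_1 by
  two, upwards at odd and downwards at even pairs.\<close>

subsection \<open>Spans of real vectors\<close>

abbreviation vspan :: "nat \<Rightarrow> real vec set \<Rightarrow> real vec set" where
  "vspan N X \<equiv> LinearCombinations.module.span class_ring (module_vec TYPE(real) N) X"

lemma vspan_zero: "0\<^sub>v N \<in> vspan N X"
proof -
  interpret vec_space "TYPE(real)" N .
  show ?thesis by (rule span_zero)
qed

lemma vspan_add:
  assumes "X \<subseteq> carrier_vec N" "a \<in> vspan N X" "b \<in> vspan N X"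
  shows "a + b \<in> vspan N X"
proof -
  interpret vec_space "TYPE(real)" N .
  show ?thesis using assms span_add1 by simp
qed

lemma vspan_smult:
  assumes "X \<subseteq> carrier_vec N" "a \<in> vspan N X"
  shows "c \<cdot>\<^sub>v a \<in> vspan N X"
proof -
  interpret vec_space "TYPE(real)" N .
  show ?thesis using assms smult_in_span by simp
qed

lemma vspan_base:
  assumes "X \<subseteq> carrier_vec N" "a \<in> X"
  shows "a \<in> vspan N X"
proof -
  interpret vec_space "TYPE(real)" N .
  show ?thesis using assms in_own_span[of X] by auto
qed

lemma vspan_carrier:
  assumes "X \<subseteq> carrier_vec N" "a \<in> vspan N X"
  shows "a \<in> carrier_vec N"
proof -
  interpret vec_space "TYPE(real)" N .
  show ?thesis using assms span_is_subset2[of X] by auto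
qed

lemma vspan_minus:
  assumes X: "X \<subseteq> carrier_vec N" and ab: "a \<in> vspan N X" "b \<in> vspan N X"
  shows "a - b \<in> vspan N X"
proof -
  have "a - b = a + (-1) \<cdot>\<^sub>v b"
    using ab[THEN vspan_carrier[OF X]] by auto
  then show ?thesis using vspan_add[OF X ab(1) vspan_smult[OF X ab(2)]] by simp
qed

text \<open>The carrier vectors satisfying \<open>P\<close> form a submodule, and the span is the
  least submodule above \<open>X\<close>. Intersecting with the carrier lets the closure assumptions
  presuppose membership in it.\<close>

lemma vspan_induct:
  assumes X: "X \<subseteq> carrier_vec N" and a: "a \<in> vspan N X"
    and zero: "P (0\<^sub>v N)" and base: "\<And>a. a \<in> X \<Longrightarrow> P a"
    and add: "\<And>a b. a \<in> carrier_vec N \<Longrightarrow> b \<in> carrier_vec N \<Longrightarrow> P a \<Longrightarrow> P b \<Longrightarrow> P (a + b)"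
    and smult: "\<And>c a. a \<in> carrier_vec N \<Longrightarrow> P a \<Longrightarrow> P (c \<cdot>\<^sub>v a)"
  shows "P a"
proof -
  interpret vec_space "TYPE(real)" N .
  have "submodule class_ring {a \<in> carrier_vec N. P a} V"
    by unfold_locales (use zero add smult in \<open>auto simp: class_ring_simps module_vec_simps\<close>)
  then have "span X \<subseteq> {a \<in> carrier_vec N. P a}"
    by (rule span_is_subset[rotated]) (use X base in auto)
  then show ?thesis using a by blast
qed

lemma vspan_least:
  assumes "X \<subseteq> carrier_vec N" "Y \<subseteq> carrier_vec N" "\<And>a. a \<in> X \<Longrightarrow> a \<in> vspan N Y"
    and "b \<in> vspan N X"
  shows "b \<in> vspan N Y"
  using assms(1,4)
  by (rule vspan_induct) (simp_all add: assms(2,3) vspan_zero vspan_add vspan_smult)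

lemma vspan_mono:
  assumes "Y \<subseteq> carrier_vec N" "X \<subseteq> Y" "a \<in> vspan N X"
  shows "a \<in> vspan N Y"
  using assms vspan_least[of X N Y a] vspan_base[OF assms(1)] by blast

lemma mult_mat_vec_zero: "A \<in> carrier_mat m N \<Longrightarrow> A *\<^sub>v 0\<^sub>v N = (0\<^sub>v m :: real vec)"
  by (intro eq_vecI) auto

lemma vspan_mult_mat_vec:
  assumes X: "X \<subseteq> carrier_vec N" and Y: "Y \<subseteq> carrier_vec N" and A: "A \<in> carrier_mat N N"
    and AX: "\<And>a. a \<in> X \<Longrightarrow> A *\<^sub>v a \<in> vspan N Y" and b: "b \<in> vspan N X"
  shows "A *\<^sub>v b \<in> vspan N Y"
  using X b
proof (rule vspan_induct)
  show "A *\<^sub>v 0\<^sub>v N \<in> vspan N Y"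
    using A vspan_zero by (simp add: mult_mat_vec_zero[OF A])
qed (simp_all add: AX Y mult_add_distrib_mat_vec[OF A] mult_mat_vec[OF A] vspan_add vspan_smult)

lemma vspan_Un:
  assumes X: "X \<subseteq> carrier_vec N" and Y: "Y \<subseteq> carrier_vec N"
  shows "vspan N (X \<union> Y) = subspace_sum (vspan N X) (vspan N Y)"
proof
  have XY: "X \<union> Y \<subseteq> carrier_vec N" using X Y by auto
  show "subspace_sum (vspan N X) (vspan N Y) \<subseteq> vspan N (X \<union> Y)"
    unfolding subspace_sum_def
    using vspan_add[OF XY] vspan_mono[OF XY] by blast
  show "vspan N (X \<union> Y) \<subseteq> subspace_sum (vspan N X) (vspan N Y)"
  proof
    fix a assume "a \<in> vspan N (X \<union> Y)"
    with XY have "\<exists>b \<in> vspan N X. \<exists>c \<in> vspan N Y. a = b + c"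
    proof (rule vspan_induct)
      show "\<exists>b \<in> vspan N X. \<exists>c \<in> vspan N Y. 0\<^sub>v N = b + c"
        by (intro bexI[of _ "0\<^sub>v N"] vspan_zero) auto
    next
      fix a assume "a \<in> X \<union> Y"
      then show "\<exists>b \<in> vspan N X. \<exists>c \<in> vspan N Y. a = b + c"
      proof
        assume a: "a \<in> X"
        with X have "a = a + 0\<^sub>v N" by auto
        then show ?thesis using a vspan_base[OF X a] vspan_zero by blast
      next
        assume a: "a \<in> Y"
        with Y have "a = 0\<^sub>v N + a" by auto
        then show ?thesis using a vspan_base[OF Y a] vspan_zero by blast
      qed
    next
      fix a a' assume "\<exists>b \<in> vspan N X. \<exists>c \<in> vspan N Y. a = b + c"
        "\<exists>b \<in> vspan N X. \<exists>c \<in> vspan N Y. a' = b + c"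
      then obtain b c b' c' where *: "b \<in> vspan N X" "c \<in> vspan N Y" "a = b + c"
        "b' \<in> vspan N X" "c' \<in> vspan N Y" "a' = b' + c'" by blast
      note car = *(1,4)[THEN vspan_carrier[OF X]] *(2,5)[THEN vspan_carrier[OF Y]]
      have "a + a' = (b + b') + (c + c')" unfolding *
        using car by (intro eq_vecI) auto
      then show "\<exists>b \<in> vspan N X. \<exists>c \<in> vspan N Y. a + a' = b + c"
        using vspan_add[OF X *(1,4)] vspan_add[OF Y *(2,5)] by blast
    next
      fix r a assume "\<exists>b \<in> vspan N X. \<exists>c \<in> vspan N Y. a = b + c"
      then obtain b c where *: "b \<in> vspan N X" "c \<in> vspan N Y" "a = b + c" by blast
      have "r \<cdot>\<^sub>v a = r \<cdot>\<^sub>v b + r \<cdot>\<^sub>v c" unfolding *(3)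
        using vspan_carrier[OF X *(1)] vspan_carrier[OF Y *(2)] by (rule smult_add_distrib_vec)
      then show "\<exists>b \<in> vspan N X. \<exists>c \<in> vspan N Y. r \<cdot>\<^sub>v a = b + c"
        using vspan_smult[OF X *(1)] vspan_smult[OF Y *(2)] by blast
    qed
    then show "a \<in> subspace_sum (vspan N X) (vspan N Y)"
      unfolding subspace_sum_def by auto
  qed
qed

subsection \<open>The symplectic form\<close>

lemma J_mat_carrier: "J_mat m \<in> carrier_mat (2 * m) (2 * m)"
  unfolding J_mat_def mult_2 by (rule four_block_carrier_mat) auto

lemma J_mat_dim [simp]: "dim_row (J_mat m) = 2 * m" "dim_col (J_mat m) = 2 * m"
  using J_mat_carrier[of m] by auto

lemma J_mat_mult_carrier [simp]: "a \<in> carrier_vec (2 * m) \<Longrightarrow> J_mat m *\<^sub>v a \<in> carrier_vec (2 * m)"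
  by (rule mult_mat_vec_carrier[OF J_mat_carrier])

lemma J_mat_index:
  assumes "i < 2 * m" "j < 2 * m"
  shows "J_mat m $$ (i, j) = (if i < m then if j < m then 0 else if i = j - m then 1 else 0
    else if j < m then if i - m = j then -1 else 0 else 0)"
  using assms unfolding J_mat_def by simp

lemma J_mat_transpose_block:
  "(J_mat m)\<^sup>T = four_block_mat (0\<^sub>m m m) (- 1\<^sub>m m) (1\<^sub>m m) (0\<^sub>m m m)"
  unfolding J_mat_def
  by (subst transpose_four_block_mat[of _ m m _ m _ m]) (simp_all add: transpose_uminus)

lemma J_mat_transpose: "(J_mat m)\<^sup>T = - J_mat m"
  unfolding J_mat_transpose_block unfolding J_mat_def by (rule eq_matI) simp_all

lemma J_mat_transpose_mult:
  "J_mat m * (J_mat m)\<^sup>T = 1\<^sub>m (2 * m)" "(J_mat m)\<^sup>T * J_mat m = 1\<^sub>m (2 * m)"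
proof -
  have *: "- (- 1\<^sub>m m) = (1\<^sub>m m :: real mat)" "- 0\<^sub>m m m = (0\<^sub>m m m :: real mat)"
    by (rule eq_matI; simp)+
  show "J_mat m * (J_mat m)\<^sup>T = 1\<^sub>m (2 * m)"
    unfolding J_mat_transpose_block unfolding J_mat_def
    by (subst mult_four_block_mat[of _ m m _ m _ m _ _ m _ m]) (simp_all add: * mult_2)
  then show "(J_mat m)\<^sup>T * J_mat m = 1\<^sub>m (2 * m)"
    by (rule mat_mult_left_right_inverse[rotated -1]) (simp_all add: J_mat_carrier)
qed

lemma J_form_add_right:
  assumes "a \<in> carrier_vec (2 * n)" "b \<in> carrier_vec (2 * n)" "c \<in> carrier_vec (2 * n)"
  shows "J_form n a (b + c) = J_form n a b + J_form n a c"
  unfolding J_form_def using assms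
  by (simp add: mult_add_distrib_mat_vec[OF J_mat_carrier] scalar_prod_add_distrib[of _ "2 * n"])

lemma J_form_smult_right:
  assumes "a \<in> carrier_vec (2 * n)" "b \<in> carrier_vec (2 * n)"
  shows "J_form n a (r \<cdot>\<^sub>v b) = r * J_form n a b"
  unfolding J_form_def using assms
  by (simp add: mult_mat_vec[OF J_mat_carrier])

lemma J_form_minus_right:
  assumes "a \<in> carrier_vec (2 * n)" "b \<in> carrier_vec (2 * n)" "c \<in> carrier_vec (2 * n)"
  shows "J_form n a (b - c) = J_form n a b - J_form n a c"
  unfolding J_form_def using assms
  by (simp add: mult_minus_distrib_mat_vec[OF J_mat_carrier] scalar_prod_minus_distrib[of _ "2 * n"])

lemma J_form_zero_right:
  assumes "a \<in> carrier_vec (2 * n)"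
  shows "J_form n a (0\<^sub>v (2 * n)) = 0"
  unfolding J_form_def using assms by (simp add: mult_mat_vec_zero[OF J_mat_carrier])

lemma J_form_skew:
  assumes a: "a \<in> carrier_vec (2 * n)" and b: "b \<in> carrier_vec (2 * n)"
  shows "J_form n a b = - J_form n b a"
proof -
  have "J_form n a b = (J_mat n *\<^sub>v b) \<bullet> a"
    unfolding J_form_def using a b by (intro comm_scalar_prod[of _ "2 * n"]) auto
  also have "\<dots> = b \<bullet> ((J_mat n)\<^sup>T *\<^sub>v a)"
    using transpose_vec_mult_scalar[of "(J_mat n)\<^sup>T" "2 * n" "2 * n" a b] a b by (simp add: J_mat_carrier)
  also have "\<dots> = - J_form n b a"
    unfolding J_mat_transpose J_form_def using a b
    by (subst uminus_mult_mat_vec) auto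
  finally show ?thesis .
qed

lemma J_form_self:
  "a \<in> carrier_vec (2 * n) \<Longrightarrow> J_form n a a = 0"
  using J_form_skew[of a n a] by simp

text \<open>Symmetry of J H makes the form of a with H b symmetric in a and b; skewness of the form
  turns this into a change of sign.\<close>

lemma hamiltonian_skew_adjoint:
  assumes H: "hamiltonian_mat n H" and a: "a \<in> carrier_vec (2 * n)" and b: "b \<in> carrier_vec (2 * n)"
  shows "J_form n a (H *\<^sub>v b) = - J_form n (H *\<^sub>v a) b"
proof -
  have Hc: "H \<in> carrier_mat (2 * n) (2 * n)" and sym: "J_mat n * H = (J_mat n * H)\<^sup>T"
    using H by (auto simp: hamiltonian_mat_def)
  have JH: "J_mat n * H \<in> carrier_mat (2 * n) (2 * n)"
    by (rule mult_carrier_mat[OF J_mat_carrier Hc])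
  have *: "J_form n c (H *\<^sub>v d) = c \<bullet> ((J_mat n * H) *\<^sub>v d)"
    if "d \<in> carrier_vec (2 * n)" for c d
    unfolding J_form_def assoc_mult_mat_vec[OF J_mat_carrier Hc that] by (rule refl)
  have "J_form n a (H *\<^sub>v b) = ((J_mat n * H)\<^sup>T *\<^sub>v a) \<bullet> b"
    unfolding *[OF b] by (rule transpose_vec_mult_scalar[OF JH b a, symmetric])
  also have "\<dots> = b \<bullet> ((J_mat n * H) *\<^sub>v a)"
    unfolding sym[symmetric] using JH a b by (intro comm_scalar_prod[of _ "2 * n"]) auto
  also have "\<dots> = J_form n b (H *\<^sub>v a)" by (rule *[OF a, symmetric])
  also have "\<dots> = - J_form n (H *\<^sub>v a) b"
    by (rule J_form_skew[OF b mult_mat_vec_carrier[OF Hc a]])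
  finally show ?thesis .
qed

lemma inv_mat_carrier_inverse:
  assumes A: "A \<in> carrier_mat N N" and inv: "invertible_mat A"
  shows "inv_mat A \<in> carrier_mat N N" "A * inv_mat A = 1\<^sub>m N" "inv_mat A * A = 1\<^sub>m N"
proof -
  obtain B where B: "A * B = 1\<^sub>m (dim_row A)" "B * A = 1\<^sub>m (dim_row B)"
    using inv unfolding invertible_mat_def inverts_mat_def by blast
  \<comment> \<open>\<open>invertible_mat\<close> does not fix the shape of \<open>B\<close>; both
    dimensions are read off by counting columns of the two products.\<close>
  have "dim_col B = N" using arg_cong[OF B(1), of dim_col] A by simp
  moreover have "dim_row B = N" using arg_cong[OF B(2), of dim_col] A by simp
  ultimately have Bc: "B \<in> carrier_mat N N" by auto
  have "A \<in> Units (ring_mat TYPE(real) N ())"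
    unfolding Units_def using A B Bc by (auto simp: ring_mat_def)
  then have "mat_inverse A \<noteq> None" using mat_inverse(1)[OF A, where b = "()"] by blast
  then obtain C where C: "mat_inverse A = Some C" by blast
  show "inv_mat A \<in> carrier_mat N N" "A * inv_mat A = 1\<^sub>m N" "inv_mat A * A = 1\<^sub>m N"
    using mat_inverse(2)[OF A C] unfolding inv_mat_def C by auto
qed

text \<open>The last claim is uniqueness: if w - z = S b and z is J-orthogonal to the columns, then
  S^T J w = J_m b, and since J_m is orthogonal, b is the coefficient vector that \<open>P\<close>
  subtracts.\<close>

lemma symplectic_projection:
  assumes S: "S \<in> carrier_mat (2 * n) (2 * m)" and SJS: "S\<^sup>T * J_mat n * S = J_mat m"
    and w: "w \<in> carrier_vec (2 * n)"
  defines "P \<equiv> 1\<^sub>m (2 * n) - S * (J_mat m)\<^sup>T * S\<^sup>T * J_mat n"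
  shows "w - P *\<^sub>v w \<in> vspan (2 * n) (set (cols S))"
    and "s \<in> set (cols S) \<Longrightarrow> J_form n s (P *\<^sub>v w) = 0"
    and "P *\<^sub>v w \<in> carrier_vec (2 * n)"
    and "w - z \<in> vspan (2 * n) (set (cols S)) \<Longrightarrow> z \<in> carrier_vec (2 * n) \<Longrightarrow>
      \<forall>s \<in> set (cols S). J_form n s z = 0 \<Longrightarrow> P *\<^sub>v w = z"
proof -
  interpret vec_space "TYPE(real)" "2 * n" .
  note J = J_mat_carrier[of n]
  note Jm = J_mat_carrier[of m]
  have JmT: "(J_mat m)\<^sup>T \<in> carrier_mat (2 * m) (2 * m)" using Jm by simp
  have ST: "S\<^sup>T \<in> carrier_mat (2 * m) (2 * n)" using S by simp
  have range: "vspan (2 * n) (set (cols S)) = {S *\<^sub>v c | c. c \<in> carrier_vec (2 * m)}"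
    using col_space_eq[OF S] S unfolding col_space_def by auto
  \<comment> \<open>The pairings of z with all columns of \<open>S\<close>; the kernel of
    \<open>c\<close> is their J-orthogonal complement.\<close>
  define c where "c z = S\<^sup>T *\<^sub>v (J_mat n *\<^sub>v z)" for z
  have c: "c z \<in> carrier_vec (2 * m)" if "z \<in> carrier_vec (2 * n)" for z
    unfolding c_def using that by (intro mult_mat_vec_carrier[OF ST]) simp
  define d where "d = (J_mat m)\<^sup>T *\<^sub>v c w"
  have d: "d \<in> carrier_vec (2 * m)"
    unfolding d_def by (rule mult_mat_vec_carrier[OF JmT c[OF w]])
  have Sc: "S *\<^sub>v b \<in> carrier_vec (2 * n)" if "b \<in> carrier_vec (2 * m)" for b
    by (rule mult_mat_vec_carrier[OF S that])
  have Pw: "P *\<^sub>v w = w - S *\<^sub>v d"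
  proof -
    have M: "S * (J_mat m)\<^sup>T \<in> carrier_mat (2 * n) (2 * m)"
      "S * (J_mat m)\<^sup>T * S\<^sup>T \<in> carrier_mat (2 * n) (2 * n)"
      "S * (J_mat m)\<^sup>T * S\<^sup>T * J_mat n \<in> carrier_mat (2 * n) (2 * n)"
      using S JmT ST J by (meson mult_carrier_mat)+
    have "P *\<^sub>v w = 1\<^sub>m (2 * n) *\<^sub>v w - (S * (J_mat m)\<^sup>T * S\<^sup>T * J_mat n) *\<^sub>v w"
      unfolding P_def by (rule minus_mult_distrib_mat_vec[OF one_carrier_mat M(3) w])
    also have "(S * (J_mat m)\<^sup>T * S\<^sup>T * J_mat n) *\<^sub>v w = S *\<^sub>v d"
      unfolding assoc_mult_mat_vec[OF M(2) J w]
        assoc_mult_mat_vec[OF M(1) ST J_mat_mult_carrier[OF w]] d_def c_def[symmetric]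
      by (rule assoc_mult_mat_vec[OF S JmT c[OF w]])
    finally show ?thesis using w by simp
  qed
  show Pc: "P *\<^sub>v w \<in> carrier_vec (2 * n)" unfolding Pw using Sc[OF d] w by simp
  have SJSc: "c (S *\<^sub>v b) = J_mat m *\<^sub>v b" if b: "b \<in> carrier_vec (2 * m)" for b
  proof -
    have M: "S\<^sup>T * J_mat n \<in> carrier_mat (2 * m) (2 * n)" using ST J by (rule mult_carrier_mat)
    have "J_mat m *\<^sub>v b = (S\<^sup>T * J_mat n * S) *\<^sub>v b" by (simp only: SJS)
    also have "\<dots> = c (S *\<^sub>v b)" unfolding c_def
      unfolding assoc_mult_mat_vec[OF M S b] by (rule assoc_mult_mat_vec[OF ST J Sc[OF b]])
    finally show ?thesis by simp
  qed
  have cminus: "c (a - b) = c a - c b" if "a \<in> carrier_vec (2 * n)" "b \<in> carrier_vec (2 * n)" for a b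
    unfolding c_def mult_minus_distrib_mat_vec[OF J that]
    by (rule mult_minus_distrib_mat_vec[OF ST J_mat_mult_carrier J_mat_mult_carrier]; fact)
  have orth: "(\<forall>s \<in> set (cols S). J_form n s z = 0) \<longleftrightarrow> c z = 0\<^sub>v (2 * m)" for z
  proof -
    have "c z $ i = J_form n (col S i) z" if "i < 2 * m" for i
      unfolding c_def J_form_def using that S by simp
    then have "c z = 0\<^sub>v (2 * m) \<longleftrightarrow> (\<forall>i < 2 * m. J_form n (col S i) z = 0)"
      using S by (auto simp: vec_eq_iff c_def)
    then show ?thesis using S by (auto simp: cols_def)
  qed
  show "w - P *\<^sub>v w \<in> vspan (2 * n) (set (cols S))"
  proof -
    have "w - P *\<^sub>v w = S *\<^sub>v d"
      unfolding Pw using w Sc[OF d] by (intro eq_vecI) auto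
    then show ?thesis unfolding range using d by blast
  qed
  show "J_form n s (P *\<^sub>v w) = 0" if "s \<in> set (cols S)"
  proof -
    have "J_mat m *\<^sub>v d = (J_mat m * (J_mat m)\<^sup>T) *\<^sub>v c w"
      unfolding d_def by (rule assoc_mult_mat_vec[OF Jm JmT c[OF w], symmetric])
    then have "J_mat m *\<^sub>v d = c w" using c[OF w] by (simp only: J_mat_transpose_mult one_mult_mat_vec)
    then have "c (P *\<^sub>v w) = c w - c w"
      unfolding Pw using cminus[OF w Sc[OF d]] SJSc[OF d] by simp
    then have "c (P *\<^sub>v w) = 0\<^sub>v (2 * m)" using c[OF w] by simp
    then show ?thesis using orth that by blast
  qed
  show "P *\<^sub>v w = z" if z: "w - z \<in> vspan (2 * n) (set (cols S))" "z \<in> carrier_vec (2 * n)"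
    and zorth: "\<forall>s \<in> set (cols S). J_form n s z = 0"
  proof -
  obtain b where b: "b \<in> carrier_vec (2 * m)" "w - z = S *\<^sub>v b" using z(1) unfolding range by auto
  have "c z = 0\<^sub>v (2 * m)" using zorth orth by blast
  then have "J_mat m *\<^sub>v b = c w"
    using SJSc[OF b(1)] cminus[OF w z(2)] b(2) c[OF w] by simp
  then have "d = ((J_mat m)\<^sup>T * J_mat m) *\<^sub>v b"
    unfolding d_def using assoc_mult_mat_vec[OF JmT Jm b(1)] by simp
  then have "d = b" using b(1) by (simp only: J_mat_transpose_mult one_mult_mat_vec)
  then have "P *\<^sub>v w = w - (w - z)" by (simp only: Pw b(2))
  moreover have "w - (w - z) = z" using w z(2) by (intro eq_vecI) auto
  ultimately show "P *\<^sub>v w = z" by (rule trans)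
  qed
qed

lemma pow_mat_mult_vec_comm:
  fixes A :: "real mat"
  assumes A: "A \<in> carrier_mat N N" and b: "b \<in> carrier_vec N"
  shows "A ^\<^sub>m i *\<^sub>v (A *\<^sub>v b) = A *\<^sub>v (A ^\<^sub>m i *\<^sub>v b)"
  using b
proof (induction i arbitrary: b)
  case 0
  then show ?case using A by simp
next
  case (Suc i)
  have Ai: "A ^\<^sub>m i \<in> carrier_mat N N" using A by simp
  show ?case
    using Suc.IH[of "A *\<^sub>v b"] Suc.prems A
    by (simp add: assoc_mult_mat_vec[OF Ai A])
qed

lemma pow_mat_Suc_mult_vec:
  fixes A :: "real mat"
  assumes A: "A \<in> carrier_mat N N" and b: "b \<in> carrier_vec N"
  shows "A ^\<^sub>m Suc i *\<^sub>v b = A *\<^sub>v (A ^\<^sub>m i *\<^sub>v b)"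
proof -
  have "A ^\<^sub>m i \<in> carrier_mat N N" using A by simp
  from assoc_mult_mat_vec[OF this A b] pow_mat_mult_vec_comm[OF A b] show ?thesis by simp
qed

lemma pow_mat_mult_vec_carrier:
  fixes A :: "real mat"
  shows "A \<in> carrier_mat N N \<Longrightarrow> b \<in> carrier_vec N \<Longrightarrow> A ^\<^sub>m i *\<^sub>v b \<in> carrier_vec N"
  by (rule mult_mat_vec_carrier[OF pow_carrier_mat])

lemma vspan_J_form_zero:
  assumes X: "X \<subseteq> carrier_vec (2 * n)" and b: "b \<in> carrier_vec (2 * n)"
    and zero: "\<And>s. s \<in> X \<Longrightarrow> J_form n s b = 0" and a: "a \<in> vspan (2 * n) X"
  shows "J_form n a b = 0"
proof -
  \<comment> \<open>Linearity is available in the right argument, so the arguments are swapped for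
    the induction over the span.\<close>
  have "J_form n b a = 0"
    using X a
  proof (rule vspan_induct)
    fix s assume s: "s \<in> X"
    then show "J_form n b s = 0"
      using zero[OF s] J_form_skew[OF b, of s] X by auto
  qed (simp_all add: b J_form_zero_right J_form_add_right J_form_smult_right)
  then show ?thesis
    using J_form_skew[OF vspan_carrier[OF X a] b] by simp
qed

subsection \<open>The sequence of J-orthogonal pairs\<close>

definition pair_vecs :: "(nat \<Rightarrow> real vec) \<Rightarrow> (nat \<Rightarrow> real vec) \<Rightarrow> nat \<Rightarrow> real vec set" where
  "pair_vecs p t m = p ` {1..m} \<union> t ` {1..m}"

definition J_orthogonal ::
  "nat \<Rightarrow> (nat \<Rightarrow> real vec) \<Rightarrow> (nat \<Rightarrow> real vec) \<Rightarrow> (nat \<Rightarrow> real) \<Rightarrow> nat \<Rightarrow> bool" where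
  "J_orthogonal n p t \<sigma> m \<longleftrightarrow> (\<forall>i\<in>{1..m}. \<forall>j\<in>{1..m}.
     J_form n (p i) (p j) = 0 \<and> J_form n (t i) (t j) = 0 \<and>
     J_form n (p i) (t j) = (if i = j then \<sigma> i else 0))"

text \<open>A relation rather than a function, so that a projection can be guessed and verified
  without touching a matrix.\<close>

definition J_projection :: "nat \<Rightarrow> real vec set \<Rightarrow> real vec \<Rightarrow> real vec \<Rightarrow> bool" where
  "J_projection n X w z \<longleftrightarrow>
     z \<in> carrier_vec (2 * n) \<and> w - z \<in> vspan (2 * n) X \<and> (\<forall>s\<in>X. J_form n s z = 0)"

definition alt_sign :: "nat \<Rightarrow> real" where
  "alt_sign m = (if odd m then 1 else -1)"

lemma alt_sign_mult_self [simp]: "alt_sign m * alt_sign m = 1" "alt_sign m * (alt_sign m * r) = r"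
  by (simp_all add: alt_sign_def)

lemma alt_sign_nonzero [simp]: "alt_sign m \<noteq> 0"
  by (simp add: alt_sign_def)

definition step_mat :: "real mat \<Rightarrow> real mat \<Rightarrow> nat \<Rightarrow> real mat" where
  "step_mat H K m = (if odd m then H else K)"

text \<open>Step m + 1 starts from the last pair built with the same matrix, which lies two pairs
  back. Step 2 has no such predecessor and starts from the first vector.\<close>

definition step_start :: "(nat \<Rightarrow> real vec) \<Rightarrow> (nat \<Rightarrow> real vec) \<Rightarrow> nat \<Rightarrow> real vec" where
  "step_start p t m = (if m = 1 then p 1 else t (m - 1))"

text \<open>\<open>t_Suc\<close> merges two normalisations: v is divided by the form of u with w_v,
  but y by the form of w_y with x, which is minus the form of x with w_y; \<open>alt_sign\<close>
  absorbs the sign. The zero vectors at index 0 let one recurrence serve the first steps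
  too.\<close>

locale heks =
  fixes n M :: nat and H K :: "real mat" and P :: "nat \<Rightarrow> real mat" and p t :: "nat \<Rightarrow> real vec"
  assumes H: "H \<in> carrier_mat (2 * n) (2 * n)" and K: "K \<in> carrier_mat (2 * n) (2 * n)"
    and HK: "H * K = 1\<^sub>m (2 * n)" and KH: "K * H = 1\<^sub>m (2 * n)"
    and ham: "hamiltonian_mat n H"
    and P_carrier: "P m \<in> carrier_mat (2 * n) (2 * n)"
    and P_iff: "\<And>m w z. m \<ge> 1 \<Longrightarrow> m \<le> M \<Longrightarrow> pair_vecs p t m \<subseteq> carrier_vec (2 * n) \<Longrightarrow>
      J_orthogonal n p t alt_sign m \<Longrightarrow> w \<in> carrier_vec (2 * n) \<Longrightarrow>
      J_projection n (pair_vecs p t m) w z \<longleftrightarrow> P m *\<^sub>v w = z"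
    and p1: "p 1 \<in> carrier_vec (2 * n)"
    and t1_nonzero: "J_form n (p 1) (H *\<^sub>v p 1) \<noteq> 0"
    and t1: "t 1 = (1 / J_form n (p 1) (H *\<^sub>v p 1)) \<cdot>\<^sub>v (H *\<^sub>v p 1)"
    and p_norm: "\<And>m. 1 \<le> m \<Longrightarrow> m < M \<Longrightarrow> norm2 (P m *\<^sub>v (step_mat H K (Suc m) *\<^sub>v step_start p t m)) \<noteq> 0"
    and p_Suc: "\<And>m. 1 \<le> m \<Longrightarrow> m < M \<Longrightarrow> p (Suc m) =
      (1 / norm2 (P m *\<^sub>v (step_mat H K (Suc m) *\<^sub>v step_start p t m))) \<cdot>\<^sub>v (P m *\<^sub>v (step_mat H K (Suc m) *\<^sub>v step_start p t m))"
    and t_nonzero: "\<And>m. 1 \<le> m \<Longrightarrow> m < M \<Longrightarrow>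
      J_form n (p (Suc m)) (P m *\<^sub>v (step_mat H K (Suc m) *\<^sub>v p (Suc m))) \<noteq> 0"
    and t_Suc: "\<And>m. 1 \<le> m \<Longrightarrow> m < M \<Longrightarrow> t (Suc m) =
      (alt_sign (Suc m) / J_form n (p (Suc m)) (P m *\<^sub>v (step_mat H K (Suc m) *\<^sub>v p (Suc m))))
        \<cdot>\<^sub>v (P m *\<^sub>v (step_mat H K (Suc m) *\<^sub>v p (Suc m)))"
    and p0: "p 0 = 0\<^sub>v (2 * n)" and t0: "t 0 = 0\<^sub>v (2 * n)"
begin

abbreviation "A \<equiv> step_mat H K"
abbreviation "st \<equiv> step_start p t"
abbreviation "N \<equiv> 2 * n"
abbreviation "\<omega> \<equiv> J_form n"
abbreviation "C \<equiv> pair_vecs p t"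
abbreviation "D m \<equiv> insert (p (Suc m)) (C m)"

lemma A_carrier: "A m \<in> carrier_mat N N"
  using H K by (simp add: step_mat_def)

lemma A_vec [simp]: "a \<in> carrier_vec N \<Longrightarrow> A m *\<^sub>v a \<in> carrier_vec N"
  by (rule mult_mat_vec_carrier[OF A_carrier])

lemma A_inverse:
  assumes "a \<in> carrier_vec N" "odd i \<noteq> odd j"
  shows "A i *\<^sub>v (A j *\<^sub>v a) = a"
  using assms assoc_mult_mat_vec[OF H K, of a] assoc_mult_mat_vec[OF K H, of a]
  by (auto simp: step_mat_def HK KH)

lemma K_skew:
  assumes a: "a \<in> carrier_vec N" and b: "b \<in> carrier_vec N"
  shows "\<omega> a (K *\<^sub>v b) = - \<omega> (K *\<^sub>v a) b"
proof -
  have Ka: "K *\<^sub>v a \<in> carrier_vec N" and Kb: "K *\<^sub>v b \<in> carrier_vec N"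
    using K a b by (auto intro: mult_mat_vec_carrier)
  have "H *\<^sub>v (K *\<^sub>v a) = a" "H *\<^sub>v (K *\<^sub>v b) = b"
    using A_inverse[OF a, of 1 0] A_inverse[OF b, of 1 0] by (simp_all add: step_mat_def)
  then show ?thesis using hamiltonian_skew_adjoint[OF ham Ka Kb] by simp
qed

lemma A_skew:
  "a \<in> carrier_vec N \<Longrightarrow> b \<in> carrier_vec N \<Longrightarrow> \<omega> a (A m *\<^sub>v b) = - \<omega> (A m *\<^sub>v a) b"
  using K_skew hamiltonian_skew_adjoint[OF ham] by (simp add: step_mat_def)

text \<open>Needed when coefficients are matched with \<beta>, e and g of the theorem, whose
  arguments come in the opposite order.\<close>

lemma A_symmetric:
  assumes "a \<in> carrier_vec N" "b \<in> carrier_vec N"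
  shows "\<omega> a (A m *\<^sub>v b) = \<omega> b (A m *\<^sub>v a)"
  using A_skew[OF assms, of m] J_form_skew[of "A m *\<^sub>v a" n b] assms by simp

lemma st_mem: "1 \<le> m \<Longrightarrow> st m \<in> C m"
  by (auto simp: step_start_def pair_vecs_def)

lemma C_mono: "i \<le> j \<Longrightarrow> C i \<subseteq> C j"
  by (auto simp: pair_vecs_def)

lemma P_vec [simp]: "a \<in> carrier_vec N \<Longrightarrow> P m *\<^sub>v a \<in> carrier_vec N"
  by (rule mult_mat_vec_carrier[OF P_carrier])

section \<open>J-orthogonality of the pairs\<close>

lemma carrier_J_orthogonal:
  assumes "1 \<le> m" "m \<le> M"
  shows "C m \<subseteq> carrier_vec N \<and> J_orthogonal n p t alt_sign m"
  using assms
proof (induction m rule: nat_induct_at_least)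
  case base
  have Hp: "H *\<^sub>v p 1 \<in> carrier_vec N" using H p1 by (rule mult_mat_vec_carrier)
  then have t: "t 1 \<in> carrier_vec N" unfolding t1 by simp
  have "\<omega> (p 1) (t 1) = 1"
    using t1_nonzero unfolding t1 J_form_smult_right[OF p1 Hp] by simp
  then show ?case
    using p1 t by (simp add: pair_vecs_def J_orthogonal_def J_form_self alt_sign_def)
next
  case (Suc m)
  then have m: "1 \<le> m" "m < M" and Cm: "C m \<subseteq> carrier_vec N"
    and orth: "J_orthogonal n p t alt_sign m" by auto
  define w where "w = A (Suc m) *\<^sub>v st m"
  define w' where "w' = A (Suc m) *\<^sub>v p (Suc m)"
  have w: "w \<in> carrier_vec N" unfolding w_def using st_mem[OF m(1)] Cm by auto
  have p: "p (Suc m) \<in> carrier_vec N"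
    unfolding p_Suc[OF m] w_def[symmetric] using w by simp
  then have w': "w' \<in> carrier_vec N" unfolding w'_def by simp
  have t: "t (Suc m) \<in> carrier_vec N"
    unfolding t_Suc[OF m] w'_def[symmetric] using w' by simp
  \<comment> \<open>The induction hypothesis is exactly the premise of \<open>P_iff\<close> at m, so
    here \<open>P m\<close> is known to project.\<close>
  have proj: "\<omega> s (P m *\<^sub>v a) = 0" if "a \<in> carrier_vec N" "s \<in> C m" for a s
    using P_iff[OF m(1) _ Cm orth that(1), of "P m *\<^sub>v a"] m that(2) by (simp add: J_projection_def)
  have sp: "\<omega> s (p (Suc m)) = 0" and st: "\<omega> s (t (Suc m)) = 0" if s: "s \<in> C m" for s
    using s Cm w w' unfolding p_Suc[OF m] t_Suc[OF m] w_def[symmetric] w'_def[symmetric]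
    by (auto simp: J_form_smult_right proj)
  have ps: "\<omega> (p (Suc m)) s = 0" and ts: "\<omega> (t (Suc m)) s = 0" if s: "s \<in> C m" for s
    using sp[OF s] st[OF s] J_form_skew[OF p, of s] J_form_skew[OF t, of s] s Cm by auto
  have pt: "\<omega> (p (Suc m)) (t (Suc m)) = alt_sign (Suc m)"
    using t_nonzero[OF m] p w' unfolding t_Suc[OF m] w'_def[symmetric]
    by (simp add: J_form_smult_right)
  have mem: "p i \<in> C m" "t i \<in> C m" if "1 \<le> i" "i \<le> m" for i
    using that by (auto simp: pair_vecs_def)
  have "C (Suc m) = insert (p (Suc m)) (insert (t (Suc m)) (C m))"
    by (auto simp: pair_vecs_def atLeastAtMostSuc_conv)
  moreover have "J_orthogonal n p t alt_sign (Suc m)"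
    using orth unfolding J_orthogonal_def
    by (auto simp: le_Suc_eq sp st ps ts pt mem J_form_self p t)
  ultimately show ?case using p t Cm by auto
qed

lemma C_carrier: "m \<le> M \<Longrightarrow> C m \<subseteq> carrier_vec N"
  using carrier_J_orthogonal[of m] by (cases "m = 0") (auto simp: pair_vecs_def)

lemma pt_carrier:
  assumes "m \<le> M"
  shows "p m \<in> carrier_vec N" "t m \<in> carrier_vec N"
  using C_carrier[OF assms] p0 t0 by (cases "m = 0"; auto simp: pair_vecs_def)+

lemma D_carrier: "m < M \<Longrightarrow> D m \<subseteq> carrier_vec N"
  using C_carrier[of m] pt_carrier(1)[of "Suc m"] by auto

lemma pairing:
  assumes "1 \<le> i" "i \<le> M" "j \<le> M"
  shows "\<omega> (p i) (p j) = 0" "\<omega> (t i) (t j) = 0"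
    "\<omega> (p i) (t j) = (if i = j then alt_sign i else 0)"
    "\<omega> (t i) (p j) = (if i = j then - alt_sign i else 0)"
proof -
  have M: "1 \<le> M" using assms by simp
  note orth = carrier_J_orthogonal[OF M le_refl, THEN conjunct2, unfolded J_orthogonal_def, rule_format]
  note car = pt_carrier[OF assms(2)]
  show "\<omega> (p i) (p j) = 0" "\<omega> (t i) (t j) = 0"
    "\<omega> (p i) (t j) = (if i = j then alt_sign i else 0)"
    using orth[of i j] assms car by (cases "j = 0"; simp add: p0 t0 J_form_zero_right)+
  show "\<omega> (t i) (p j) = (if i = j then - alt_sign i else 0)"
    using orth[of j i] assms car J_form_skew[OF car(2) pt_carrier(1)[OF assms(3)]]
    by (cases "j = 0"; simp add: p0 t0 J_form_zero_right)+
qed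

lemma P_projection:
  assumes "1 \<le> m" "m \<le> M" "w \<in> carrier_vec N"
  shows "J_projection n (C m) w z \<longleftrightarrow> P m *\<^sub>v w = z"
  using P_iff assms carrier_J_orthogonal[of m] by blast

lemma P_diff:
  assumes "1 \<le> m" "m \<le> M" "w \<in> carrier_vec N"
  obtains r where "r \<in> vspan N (C m)" "r \<in> carrier_vec N" "P m *\<^sub>v w = w - r"
proof
  have *: "w - P m *\<^sub>v w \<in> vspan N (C m)"
    using P_projection[OF assms, of "P m *\<^sub>v w"] by (simp add: J_projection_def)
  then show "w - P m *\<^sub>v w \<in> vspan N (C m)" .
  from vspan_carrier[OF C_carrier[OF assms(2)] *] show "w - P m *\<^sub>v w \<in> carrier_vec N" .
  have "P m *\<^sub>v w \<in> carrier_vec N" using assms by simp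
  then show "P m *\<^sub>v w = w - (w - P m *\<^sub>v w)" using assms(3) by (intro eq_vecI) auto
qed

section \<open>Parallelism and the mapping property, proved by a joint induction\<close>

definition c where "c m = alt_sign m / \<omega> (p m) (A m *\<^sub>v p m)"

text \<open>Parallelism together with the value \<open>alt_sign m\<close> of the form at
  \<open>p m\<close> and \<open>t m\<close> forces the factor \<open>c m\<close>. The nonzero
  conjunct keeps \<open>c m\<close> away from the default value of division, so that the relation
  can be inverted.\<close>

definition t_parallel where
  "t_parallel m \<longleftrightarrow> \<omega> (p m) (A m *\<^sub>v p m) \<noteq> 0 \<and> t m = c m \<cdot>\<^sub>v (A m *\<^sub>v p m)"

definition A_maps where
  "A_maps m \<longleftrightarrow> (\<forall>s\<in>C m. A (Suc m) *\<^sub>v s \<in> vspan N (D m))"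

lemma t_parallelD:
  assumes "t_parallel m" "m \<le> M"
  shows "c m \<noteq> 0" "t m = c m \<cdot>\<^sub>v (A m *\<^sub>v p m)" "A m *\<^sub>v p m = (1 / c m) \<cdot>\<^sub>v t m"
proof -
  show c: "c m \<noteq> 0" and t: "t m = c m \<cdot>\<^sub>v (A m *\<^sub>v p m)"
    using assms by (auto simp: t_parallel_def c_def)
  show "A m *\<^sub>v p m = (1 / c m) \<cdot>\<^sub>v t m"
    unfolding t using c by (simp add: smult_smult_assoc)
qed

lemma t_parallel_Suc:
  assumes m: "1 \<le> m" "m < M" and maps: "A_maps m"
  shows "t_parallel (Suc m)"
proof -
  let ?w = "A (Suc m) *\<^sub>v p (Suc m)"
  have p: "p (Suc m) \<in> carrier_vec N" using pt_carrier(1)[of "Suc m"] m by simp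
  have "J_projection n (C m) ?w ?w"
    unfolding J_projection_def
  proof (intro conjI ballI)
    show "?w \<in> carrier_vec N" using p by simp
    then show "?w - ?w \<in> vspan N (C m)" using vspan_zero by simp
    fix s assume s: "s \<in> C m"
    then have sc: "s \<in> carrier_vec N" using C_carrier[of m] m by auto
    have "\<omega> (A (Suc m) *\<^sub>v s) (p (Suc m)) = 0"
    proof (rule vspan_J_form_zero[OF D_carrier[OF m(2)] p])
      show "A (Suc m) *\<^sub>v s \<in> vspan N (D m)" using maps s by (simp add: A_maps_def)
      fix d assume "d \<in> D m"
      then show "\<omega> d (p (Suc m)) = 0"
        using m pairing(1,4)[of _ "Suc m"] by (auto simp: pair_vecs_def)
    qed
    then show "\<omega> s ?w = 0" using A_skew[OF sc p] by simp
  qed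
  then have "P m *\<^sub>v ?w = ?w" using P_projection[of m ?w ?w] m p by simp
  then show ?thesis using t_nonzero[OF m] t_Suc[OF m] by (simp add: t_parallel_def c_def)
qed

lemma t_parallel_1: "t_parallel 1"
  using t1_nonzero t1 by (simp add: t_parallel_def c_def step_mat_def alt_sign_def)

lemma A_start_mem:
  assumes m: "1 \<le> m" "m < M"
  shows "A (Suc m) *\<^sub>v st m \<in> vspan N (D m)"
proof -
  define w where "w = A (Suc m) *\<^sub>v st m"
  have w: "w \<in> carrier_vec N" unfolding w_def using st_mem[OF m(1)] C_carrier[of m] m by auto
  note X = D_carrier[OF m(2)]
  obtain r where r: "r \<in> vspan N (C m)" "r \<in> carrier_vec N" "P m *\<^sub>v w = w - r"
    using P_diff[of m w] m w by auto
  \<comment> \<open>The definition of \<open>p (Suc m)\<close> solved for w, which a nonzero norm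
    permits.\<close>
  have "w = norm2 (P m *\<^sub>v w) \<cdot>\<^sub>v p (Suc m) + r"
    using p_norm[OF m] w r(2) unfolding p_Suc[OF m] w_def[symmetric]
    by (simp add: smult_smult_assoc r(3)) (intro eq_vecI, auto)
  moreover have "norm2 (P m *\<^sub>v w) \<cdot>\<^sub>v p (Suc m) \<in> vspan N (D m)"
    by (intro vspan_smult[OF X] vspan_base[OF X]) simp
  moreover have "r \<in> vspan N (D m)"
    using r(1) by (rule vspan_mono[OF X, rotated]) auto
  ultimately show ?thesis using vspan_add[OF X] unfolding w_def[symmetric] by metis
qed

text \<open>\<open>t m\<close> is a multiple of \<open>A m *\<^sub>v p m\<close>, and the matrix of
  the other parity is the inverse of \<open>A m\<close>.\<close>

lemma A_other_t:
  assumes "t_parallel m" "m \<le> M" "odd i \<noteq> odd m"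
  shows "A i *\<^sub>v t m = c m \<cdot>\<^sub>v p m"
  using t_parallelD(2)[OF assms(1,2)] pt_carrier(1)[OF assms(2)] A_inverse[OF _ assms(3)]
  by (simp add: mult_mat_vec[OF A_carrier])

lemma A_maps_1:
  assumes "1 < M"
  shows "A_maps 1"
  unfolding A_maps_def
proof
  fix s assume "s \<in> C 1"
  then consider "s = p 1" | "s = t 1" by (auto simp: pair_vecs_def)
  then show "A (Suc 1) *\<^sub>v s \<in> vspan N (D 1)"
  proof cases
    case 1
    then show ?thesis using A_start_mem[of 1] assms by (simp add: step_start_def)
  next
    case 2
    have "A (Suc 1) *\<^sub>v t 1 = c 1 \<cdot>\<^sub>v p 1" by (rule A_other_t[OF t_parallel_1]) (use assms in auto)
    moreover have "p 1 \<in> vspan N (D 1)"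
      by (rule vspan_base[OF D_carrier[OF assms]]) (auto simp: pair_vecs_def)
    ultimately show ?thesis using 2 vspan_smult[OF D_carrier[OF assms]] by simp
  qed
qed

lemma A_maps_Suc:
  assumes m: "1 \<le> m" "Suc m < M" and t_par: "t_parallel m" "t_parallel (Suc m)"
    and prev: "m > 1 \<Longrightarrow> A_maps (m - 1)"
  shows "A_maps (Suc m)"
proof -
  let ?X = "D (Suc m)" and ?B = "A (Suc (Suc m))"
  have X: "?X \<subseteq> carrier_vec N" using m by (intro D_carrier)
  note smult = vspan_smult[OF X] and base = vspan_base[OF X]
  have B: "?B = A m" by (simp add: step_mat_def)
  have Cm: "C m \<subseteq> carrier_vec N" and m': "m < M" using C_carrier m by auto
  have CX: "C m \<subseteq> ?X" "C (Suc m) \<subseteq> ?X" using C_mono[of m "Suc m"] by auto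
  have maps_Cm: "?B *\<^sub>v s \<in> vspan N ?X" if s: "s \<in> C m" for s
  proof -
    consider "m > 1" "s \<in> C (m - 1)" | "s = p m" | "s = t m"
      using s m(1) unfolding pair_vecs_def by (force simp: le_eq_less_or_eq Suc_le_eq)
    then show ?thesis
    proof cases
      case 1
      then have "?B *\<^sub>v s \<in> vspan N (D (m - 1))"
        using prev unfolding B A_maps_def by simp
      moreover have "D (m - 1) \<subseteq> ?X"
        using 1(1) m(1) C_mono[of "m - 1" "Suc m"] by (auto simp: pair_vecs_def)
      ultimately show ?thesis using vspan_mono[OF X] by blast
    next
      case 2
      have "t m \<in> ?X" using CX m(1) by (auto simp: pair_vecs_def)
      then show ?thesis unfolding 2 B using t_parallelD(3)[OF t_par(1)] m' smult base by simp
    next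
      \<comment> \<open>\<open>t m\<close> is \<open>st (Suc m)\<close>: its image is the vector
        projected to obtain \<open>p (Suc (Suc m))\<close>.\<close>
      case 3
      then show ?thesis using A_start_mem[of "Suc m"] m by (simp add: step_start_def)
    qed
  qed
  have maps_span: "?B *\<^sub>v a \<in> vspan N ?X" if "a \<in> vspan N (C m)" for a
    by (rule vspan_mult_mat_vec[OF Cm X A_carrier maps_Cm that])
  show ?thesis
    unfolding A_maps_def
  proof
    fix s assume "s \<in> C (Suc m)"
    then consider "s \<in> C m" | "s = p (Suc m)" | "s = t (Suc m)"
      by (auto simp: pair_vecs_def atLeastAtMostSuc_conv)
    then show "?B *\<^sub>v s \<in> vspan N ?X"
    proof cases
      case 1
      then show ?thesis by (rule maps_Cm)
    next
      case 2
      let ?w = "A (Suc m) *\<^sub>v st m"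
      have stc: "st m \<in> carrier_vec N" using st_mem[OF m(1)] Cm by auto
      obtain r where r: "r \<in> vspan N (C m)" "r \<in> carrier_vec N" "P m *\<^sub>v ?w = ?w - r"
        using P_diff[of m ?w] m stc by auto
      \<comment> \<open>\<open>p (Suc m)\<close> is a multiple of
        \<open>A (Suc m) *\<^sub>v st m - r\<close>, and \<open>?B\<close> inverts
        \<open>A (Suc m)\<close>; what remains is \<open>st m\<close> minus the image of r, where r
        lies in the span of \<open>C m\<close> already treated.\<close>
      have "?B *\<^sub>v p (Suc m) = (1 / norm2 (P m *\<^sub>v ?w)) \<cdot>\<^sub>v (?B *\<^sub>v (?w - r))"
        unfolding p_Suc[OF m(1) m'] r(3) using stc r(2)
        by (intro mult_mat_vec[OF A_carrier]) auto
      also have "?B *\<^sub>v (?w - r) = ?B *\<^sub>v ?w - ?B *\<^sub>v r"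
        using stc r(2) by (intro mult_minus_distrib_mat_vec[OF A_carrier]) auto
      also have "?B *\<^sub>v ?w = st m" using stc by (intro A_inverse) auto
      finally have "?B *\<^sub>v p (Suc m) = (1 / norm2 (P m *\<^sub>v ?w)) \<cdot>\<^sub>v (st m - ?B *\<^sub>v r)" .
      moreover have "st m \<in> vspan N ?X" using st_mem[OF m(1)] CX by (intro base) auto
      ultimately show ?thesis unfolding 2 using smult[OF vspan_minus[OF X _ maps_span[OF r(1)]]] by simp
    next
      case 3
      have "?B *\<^sub>v t (Suc m) = c (Suc m) \<cdot>\<^sub>v p (Suc m)"
        by (rule A_other_t[OF t_par(2)]) (use m in auto)
      moreover have "p (Suc m) \<in> ?X" using CX by (auto simp: pair_vecs_def)
      ultimately show ?thesis unfolding 3 using smult base by simp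
    qed
  qed
qed

text \<open>The induction is strong because \<open>A_maps_Suc\<close> looks two steps back.
  \<open>A_maps m\<close> stops short of \<open>M\<close> because it refers to
  \<open>p (Suc m)\<close>.\<close>

lemma t_parallel_A_maps:
  assumes "1 \<le> m" "m \<le> M"
  shows "t_parallel m \<and> (m < M \<longrightarrow> A_maps m)"
  using assms
proof (induction m rule: less_induct)
  case (less m)
  show ?case
  proof (cases "m = 1")
    case True
    then show ?thesis using t_parallel_1 A_maps_1 by simp
  next
    case False
    then obtain l where l: "m = Suc l" "1 \<le> l" using less.prems by (cases m) auto
    have t: "t_parallel l" "t_parallel m"
      using less.IH[of l] l less.prems t_parallel_Suc[of l] by auto
    have "A_maps (l - 1)" if "l > 1" using less.IH[of "l - 1"] that l less.prems by auto
    then have "A_maps m" if "m < M" using A_maps_Suc[of l] that l t by auto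
    then show ?thesis using t by simp
  qed
qed

lemmas t_par = t_parallel_A_maps[THEN conjunct1]

lemma A_maps: "1 \<le> m \<Longrightarrow> m < M \<Longrightarrow> A_maps m"
  using t_parallel_A_maps[of m] by simp

subsection \<open>Short recurrences\<close>

text \<open>A single term remains: \<open>A 2\<close> sends \<open>t 1\<close> to a multiple of
  \<open>p 1\<close>, so skew-adjointness makes \<open>A 2 *\<^sub>v p 1\<close> J-orthogonal to
  \<open>t 1\<close>, and no multiple of \<open>p 1\<close> is subtracted.\<close>

lemma first_step:
  assumes M: "1 < M"
  shows "P 1 *\<^sub>v (A 2 *\<^sub>v p 1) = A 2 *\<^sub>v p 1 - \<omega> (p 1) (A 2 *\<^sub>v p 1) \<cdot>\<^sub>v t 1"
proof -
  let ?a = "A 2 *\<^sub>v p 1"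
  let ?z = "?a - \<omega> (p 1) ?a \<cdot>\<^sub>v t 1"
  have a: "?a \<in> carrier_vec N" using p1 by simp
  have t: "t 1 \<in> carrier_vec N" using pt_carrier(2)[of 1] M by simp
  have C1: "C 1 = {p 1, t 1}" by (auto simp: pair_vecs_def)
  have X: "C 1 \<subseteq> carrier_vec N" using p1 t unfolding C1 by simp
  have "J_projection n (C 1) ?a ?z"
    unfolding J_projection_def
  proof (intro conjI ballI)
    show "?z \<in> carrier_vec N" using a t by (intro minus_carrier_vec) auto
    have "?a - ?z = \<omega> (p 1) ?a \<cdot>\<^sub>v t 1"
      using a t by (intro eq_vecI) (simp_all add: carrier_vecD[OF a] carrier_vecD[OF t])
    then show "?a - ?z \<in> vspan N (C 1)"
      using vspan_smult[OF X vspan_base[OF X, of "t 1"]] C1 by simp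
    have "\<omega> (t 1) ?a = - \<omega> (A 2 *\<^sub>v t 1) (p 1)" by (rule A_skew[OF t p1])
    also have "A 2 *\<^sub>v t 1 = c 1 \<cdot>\<^sub>v p 1" by (rule A_other_t[OF t_par]) (use M in auto)
    also have "- \<omega> (c 1 \<cdot>\<^sub>v p 1) (p 1) = 0"
      using p1 J_form_skew[of "c 1 \<cdot>\<^sub>v p 1" n "p 1"] by (simp add: J_form_smult_right J_form_self)
    finally have ta: "\<omega> (t 1) ?a = 0" .
    fix s assume "s \<in> C 1"
    then consider "s = p 1" | "s = t 1" unfolding C1 by auto
    then show "\<omega> s ?z = 0"
    proof cases
      case 1
      have "\<omega> (p 1) ?z = \<omega> (p 1) ?a - \<omega> (p 1) ?a * \<omega> (p 1) (t 1)"
        using p1 t a J_form_minus_right[OF p1 a, of "\<omega> (p 1) ?a \<cdot>\<^sub>v t 1"] J_form_smult_right[OF p1 t]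
        by simp
      then show ?thesis unfolding 1 using M pairing(3)[of 1 1] by (simp add: alt_sign_def)
    next
      case 2
      have "\<omega> (t 1) ?z = \<omega> (t 1) ?a - \<omega> (p 1) ?a * \<omega> (t 1) (t 1)"
        using t a J_form_minus_right[OF t a, of "\<omega> (p 1) ?a \<cdot>\<^sub>v t 1"] J_form_smult_right[OF t t]
        by simp
      then show ?thesis unfolding 2 using ta t by (simp add: J_form_self)
    qed
  qed
  then show ?thesis using P_projection[of 1 ?a ?z] M a by simp
qed

text \<open>Among the constructed vectors only \<open>p j\<close> pairs with \<open>t j\<close>, and
  for i < j the set \<open>D i\<close> reaches \<open>p j\<close> only as its last vector.\<close>

lemma D_pairing_t:
  assumes i: "i < j" "j \<le> M" "d \<in> vspan N (D i)" and j: "Suc i \<noteq> j"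
  shows "\<omega> d (t j) = 0"
proof (rule vspan_J_form_zero[OF D_carrier _ _ i(3)])
  show "i < M" "t j \<in> carrier_vec N" using i pt_carrier by auto
  fix s assume "s \<in> D i"
  then show "\<omega> s (t j) = 0"
    using pairing(2,3)[of _ j] i j by (auto simp: pair_vecs_def)
qed

text \<open>Moving \<^term>\<open>A (Suc m)\<close> to the other argument leaves \<^term>\<open>t (m - 1)\<close> paired with vectors
  among which its partner \<^term>\<open>p (m - 1)\<close> does not occur, except for the excluded indices.\<close>

lemma coefficient_p_zero:
  assumes m: "2 \<le> m" "m < M" and i: "1 \<le> i" "i \<le> m" "i \<noteq> m" "i \<noteq> m - 2"
  shows "\<omega> (p i) (A (Suc m) *\<^sub>v t (m - 1)) = 0"
proof -
  have pc: "p i \<in> carrier_vec N" "t i \<in> carrier_vec N" and tc: "t (m - 1) \<in> carrier_vec N"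
    using pt_carrier i m by auto
  have "\<omega> (A (Suc m) *\<^sub>v p i) (t (m - 1)) = 0"
  proof (cases "odd i = odd (Suc m)")
    case True
    then have "A (Suc m) *\<^sub>v p i = (1 / c i) \<cdot>\<^sub>v t i"
      using t_parallelD(3)[OF t_par, of i] i m by (simp add: step_mat_def)
    moreover have "\<omega> ((1 / c i) \<cdot>\<^sub>v t i) (t (m - 1)) = 0"
      using J_form_skew[of "(1 / c i) \<cdot>\<^sub>v t i" n "t (m - 1)"] pc tc pairing(2)[of "m - 1" i] i m
      by (simp add: J_form_smult_right)
    ultimately show ?thesis by simp
  next
    case False
    \<comment> \<open>Here i has the parity of m; with m and m - 2 excluded, i is at most m - 4, so
      \<open>D i\<close> ends before \<open>p (m - 1)\<close>.\<close>
    have small: "i + 2 < m" using i m False by presburger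
    then have "A (Suc i) *\<^sub>v p i \<in> vspan N (D i)"
      using A_maps[of i] i m by (auto simp: A_maps_def pair_vecs_def)
    moreover have "A (Suc i) = A (Suc m)" using False by (simp add: step_mat_def)
    ultimately show ?thesis using D_pairing_t[of i "m - 1"] small m by simp
  qed
  then show ?thesis using A_skew[OF pc(1) tc] by simp
qed

lemma coefficient_t_zero:
  assumes m: "2 \<le> m" "m < M" and i: "1 \<le> i" "i \<le> m" "i \<noteq> m - 1" "i \<noteq> m - 3"
  shows "\<omega> (t i) (A (Suc m) *\<^sub>v t (m - 1)) = 0"
proof -
  have pc: "p i \<in> carrier_vec N" "t i \<in> carrier_vec N" and tc: "t (m - 1) \<in> carrier_vec N"
    using pt_carrier i m by auto
  have "\<omega> (A (Suc m) *\<^sub>v t i) (t (m - 1)) = 0"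
  proof (cases "odd i = odd (Suc m)")
    case True
    \<comment> \<open>Here i has the parity of m - 1; with m - 1 and m - 3 excluded, i is at most m
      - 5, so even \<open>D (Suc i)\<close> ends before \<open>p (m - 1)\<close>.\<close>
    have small: "i + 4 < m" using i m True by presburger
    then have "A (Suc (Suc i)) *\<^sub>v t i \<in> vspan N (D (Suc i))"
      using A_maps[of "Suc i"] i m by (auto simp: A_maps_def pair_vecs_def)
    moreover have "A (Suc (Suc i)) = A (Suc m)" using True by (simp add: step_mat_def)
    ultimately show ?thesis using D_pairing_t[of "Suc i" "m - 1"] small m by simp
  next
    case False
    then have "A (Suc m) *\<^sub>v t i = c i \<cdot>\<^sub>v p i"
      by (intro A_other_t[OF t_par]) (use i m in auto)
    moreover have "\<omega> (c i \<cdot>\<^sub>v p i) (t (m - 1)) = 0"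
      using J_form_skew[of "c i \<cdot>\<^sub>v p i" n "t (m - 1)"] pc tc pairing(4)[of "m - 1" i] i m
      by (simp add: J_form_smult_right)
    ultimately show ?thesis by simp
  qed
  then show ?thesis using A_skew[OF pc(2) tc] by simp
qed

text \<open>The right-hand side is verified to be the projection. All four coefficients carry the
  same sign: passing from pairs m and m - 2 to pairs m - 1 and m - 3 flips \<open>alt_sign\<close>,
  and exchanging the roles of p and t flips the form once more. For m < 4 some indices become 0,
  where the vectors vanish.\<close>

lemma short_recurrence:
  assumes m: "2 \<le> m" "m < M"
  defines "a \<equiv> A (Suc m) *\<^sub>v t (m - 1)"
  shows "P m *\<^sub>v a = a
    - (alt_sign m * \<omega> (p m) a) \<cdot>\<^sub>v t m - (alt_sign m * \<omega> (p (m - 2)) a) \<cdot>\<^sub>v t (m - 2)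
    - (alt_sign m * \<omega> (t (m - 3)) a) \<cdot>\<^sub>v p (m - 3) - (alt_sign m * \<omega> (t (m - 1)) a) \<cdot>\<^sub>v p (m - 1)"
    (is "_ = a - ?d1 \<cdot>\<^sub>v _ - ?d2 \<cdot>\<^sub>v _ - ?d3 \<cdot>\<^sub>v _ - ?d4 \<cdot>\<^sub>v _")
proof -
  let ?z = "a - ?d1 \<cdot>\<^sub>v t m - ?d2 \<cdot>\<^sub>v t (m - 2) - ?d3 \<cdot>\<^sub>v p (m - 3) - ?d4 \<cdot>\<^sub>v p (m - 1)"
  have car: "t m \<in> carrier_vec N" "t (m - 2) \<in> carrier_vec N" "p (m - 3) \<in> carrier_vec N"
    "p (m - 1) \<in> carrier_vec N" "t (m - 1) \<in> carrier_vec N"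
    using pt_carrier m by auto
  have a: "a \<in> carrier_vec N" unfolding a_def using car by simp
  have X: "C m \<subseteq> carrier_vec N" using C_carrier m by simp
  have z: "?z \<in> carrier_vec N" using a car by (intro minus_carrier_vec smult_carrier_vec) auto
  have mem: "t j \<in> vspan N (C m)" "p j \<in> vspan N (C m)" if "j \<le> m" for j
    using vspan_base[OF X, of "t j"] vspan_base[OF X, of "p j"] vspan_zero[of N "C m"] p0 t0 that
    by (cases "j = 0"; auto simp: pair_vecs_def)+
  have form: "\<omega> s ?z = \<omega> s a - ?d1 * \<omega> s (t m) - ?d2 * \<omega> s (t (m - 2)) - ?d3 * \<omega> s (p (m - 3))
      - ?d4 * \<omega> s (p (m - 1))" if "s \<in> carrier_vec N" for s
    using that a car by (simp add: J_form_minus_right J_form_smult_right)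
  have "J_projection n (C m) a ?z"
    unfolding J_projection_def
  proof (intro conjI ballI)
    show "?z \<in> carrier_vec N" by (rule z)
    have "a - ?z = ?d1 \<cdot>\<^sub>v t m + ?d2 \<cdot>\<^sub>v t (m - 2) + ?d3 \<cdot>\<^sub>v p (m - 3) + ?d4 \<cdot>\<^sub>v p (m - 1)"
      using a car by (intro eq_vecI) auto
    also have "\<dots> \<in> vspan N (C m)"
      by (intro vspan_add[OF X] vspan_smult[OF X] mem) auto
    finally show "a - ?z \<in> vspan N (C m)" .
    fix s assume "s \<in> C m"
    then consider i where "s = p i" "1 \<le> i" "i \<le> m" | i where "s = t i" "1 \<le> i" "i \<le> m"
      by (auto simp: pair_vecs_def)
    then show "\<omega> s ?z = 0"
    proof cases
      case 1
      have i: "i \<le> M" using 1 m by simp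
      have sgn: "alt_sign (m - 2) = alt_sign m" using m(1) by (simp add: alt_sign_def)
      have "\<omega> (p i) (t m) = (if i = m then alt_sign m else 0)"
        "\<omega> (p i) (t (m - 2)) = (if i = m - 2 then alt_sign m else 0)"
        "\<omega> (p i) (p (m - 3)) = 0" "\<omega> (p i) (p (m - 1)) = 0"
        using 1(2) i m sgn by (simp_all add: pairing(1,3))
      note form[OF pt_carrier(1)[OF i], unfolded this]
      moreover have "\<omega> (p i) a = 0" if "i \<noteq> m" "i \<noteq> m - 2"
        unfolding a_def by (rule coefficient_p_zero[OF m 1(2,3) that])
      moreover have "m - 2 \<noteq> m" using m(1) by simp
      ultimately show ?thesis
        unfolding 1(1) by (cases "i = m"; cases "i = m - 2") simp_all
    next
      case 2
      have i: "i \<le> M" using 2 m by simp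
      \<comment> \<open>The premise i = m - 3 with i positive excludes truncated subtraction, which
        for m = 2 would give the wrong parity.\<close>
      have sgn: "alt_sign (m - 1) = - alt_sign m" "i = m - 3 \<Longrightarrow> alt_sign (m - 3) = - alt_sign m"
        using m(1) 2(2) by (simp_all add: alt_sign_def)
      have "\<omega> (t i) (p (m - 1)) = (if i = m - 1 then alt_sign m else 0)"
        "\<omega> (t i) (p (m - 3)) = (if i = m - 3 then alt_sign m else 0)"
        "\<omega> (t i) (t (m - 2)) = 0" "\<omega> (t i) (t m) = 0"
        using 2(2) i m sgn by (simp_all add: pairing(2,4))
      note form[OF pt_carrier(2)[OF i], unfolded this]
      moreover have "\<omega> (t i) a = 0" if "i \<noteq> m - 1" "i \<noteq> m - 3"
        unfolding a_def by (rule coefficient_t_zero[OF m 2(2,3) that])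
      moreover have "m - 3 \<noteq> m - 1" using m(1) by simp
      ultimately show ?thesis
        unfolding 2(1) by (cases "i = m - 1"; cases "i = m - 3") simp_all
    qed
  qed
  then show ?thesis using P_projection[of m a ?z] m a by simp
qed

subsection \<open>Krylov spaces\<close>

lemma A_maps_C:
  assumes m: "1 \<le> m" "m < M" and a: "a \<in> vspan N (C m)"
  shows "A (Suc m) *\<^sub>v a \<in> vspan N (D m)"
proof (rule vspan_mult_mat_vec[OF _ D_carrier[OF m(2)] A_carrier _ a])
  show "C m \<subseteq> carrier_vec N" using m by (intro C_carrier) simp
  show "\<And>s. s \<in> C m \<Longrightarrow> A (Suc m) *\<^sub>v s \<in> vspan N (D m)"
    using A_maps[OF m] by (simp add: A_maps_def)
qed

lemma A_maps_D:
  assumes m: "m < M" and a: "a \<in> vspan N (D m)"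
  shows "A (Suc m) *\<^sub>v a \<in> vspan N (C (Suc m))"
proof (rule vspan_mult_mat_vec[OF D_carrier[OF m] _ A_carrier _ a])
  show X: "C (Suc m) \<subseteq> carrier_vec N" using m by (intro C_carrier) simp
  have t: "t (Suc m) \<in> vspan N (C (Suc m))"
    by (rule vspan_base[OF X]) (auto simp: pair_vecs_def)
  fix s assume "s \<in> D m"
  \<comment> \<open>\<open>C 0\<close> is empty, so for m = 0 only \<open>p 1\<close> remains and
    \<open>A_maps\<close> is not invoked outside its range.\<close>
  then consider "s = p (Suc m)" | "s \<in> C m" "1 \<le> m" by (cases "m = 0") (auto simp: pair_vecs_def)
  then show "A (Suc m) *\<^sub>v s \<in> vspan N (C (Suc m))"
  proof cases
    case 1
    then show ?thesis
      using t_parallelD(3)[OF t_par, of "Suc m"] m vspan_smult[OF X t] by simp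
  next
    case 2
    then have "A (Suc m) *\<^sub>v s \<in> vspan N (D m)" using A_maps m by (simp add: A_maps_def)
    moreover have "D m \<subseteq> C (Suc m)" using C_mono[of m "Suc m"] by (auto simp: pair_vecs_def)
    ultimately show ?thesis using vspan_mono[OF X] by blast
  qed
qed

section \<open>Krylov vectors lie in the span of the pairs\<close>

lemma H_power_mem:
  assumes "2 * j < M"
  shows "H ^\<^sub>m (2 * j) *\<^sub>v p 1 \<in> vspan N (D (2 * j)) \<and>
    H ^\<^sub>m Suc (2 * j) *\<^sub>v p 1 \<in> vspan N (C (Suc (2 * j)))"
  using assms
proof (induction j)
  case 0
  have A1: "A (Suc 0) = H" by (simp add: step_mat_def)
  have "p 1 \<in> vspan N (D 0)" using 0 by (intro vspan_base[OF D_carrier]) auto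
  then show ?case
    using A_maps_D[of 0 "p 1"] 0 H p1 by (simp add: A1)
next
  case (Suc j)
  let ?m = "2 * Suc j"
  have m: "1 \<le> ?m" "?m < M" using Suc.prems by auto
  have A: "A (Suc ?m) = H" "A (Suc (Suc (Suc (2 * j)))) = H" by (simp_all add: step_mat_def)
  \<comment> \<open>Pair 2j + 2 is built with the inverse of H, so the span is first enlarged by it;
    only at that stage is the next step matrix H again.\<close>
  have "H ^\<^sub>m Suc (2 * j) *\<^sub>v p 1 \<in> vspan N (C ?m)"
    by (rule vspan_mono[OF _ C_mono[of "Suc (2 * j)"]])
      (use Suc m C_carrier[of ?m] in auto)
  from A_maps_C[OF m this] have 1: "H ^\<^sub>m ?m *\<^sub>v p 1 \<in> vspan N (D ?m)"
    using pow_mat_Suc_mult_vec[OF H p1, of "Suc (2 * j)"] by (simp only: A mult_Suc_right add_2_eq_Suc)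
  from A_maps_D[OF m(2) this] have "H ^\<^sub>m Suc ?m *\<^sub>v p 1 \<in> vspan N (C (Suc ?m))"
    using pow_mat_Suc_mult_vec[OF H p1, of ?m] by (simp only: A)
  with 1 show ?case by blast
qed

lemma K_power_mem:
  assumes "Suc (2 * j) < M"
  shows "K ^\<^sub>m Suc (2 * j) *\<^sub>v p 1 \<in> vspan N (D (Suc (2 * j))) \<and>
    K ^\<^sub>m Suc (Suc (2 * j)) *\<^sub>v p 1 \<in> vspan N (C (Suc (Suc (2 * j))))"
  using assms
proof (induction j)
  case 0
  have "p 1 \<in> vspan N (C 1)"
    using 0 by (intro vspan_base[OF C_carrier]) (auto simp: pair_vecs_def)
  then have "A 2 *\<^sub>v p 1 \<in> vspan N (D 1)" using A_maps_C[of 1 "p 1"] 0 by (simp add: numeral_2_eq_2)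
  then have 1: "K ^\<^sub>m Suc 0 *\<^sub>v p 1 \<in> vspan N (D (Suc 0))" using K by (simp add: step_mat_def)
  then have "K *\<^sub>v (K ^\<^sub>m Suc 0 *\<^sub>v p 1) \<in> vspan N (C (Suc (Suc 0)))"
    using A_maps_D[of "Suc 0" "K ^\<^sub>m Suc 0 *\<^sub>v p 1"] 0 by (simp add: step_mat_def)
  with 1 show ?case using pow_mat_Suc_mult_vec[OF K p1, of "Suc 0"] by (simp only: mult_0_right)
next
  case (Suc j)
  let ?m = "Suc (2 * Suc j)"
  have m: "1 \<le> ?m" "?m < M" using Suc.prems by auto
  have A: "A (Suc ?m) = K" by (simp add: step_mat_def)
  have "K ^\<^sub>m (2 * Suc j) *\<^sub>v p 1 \<in> vspan N (C ?m)"
    by (rule vspan_mono[OF _ C_mono[of "Suc (Suc (2 * j))"]])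
      (use Suc m C_carrier[of ?m] in auto)
  from A_maps_C[OF m this] have 1: "K ^\<^sub>m ?m *\<^sub>v p 1 \<in> vspan N (D ?m)"
    using pow_mat_Suc_mult_vec[OF K p1, of "2 * Suc j"] by (simp only: A)
  from A_maps_D[OF m(2) this] have "K ^\<^sub>m Suc ?m *\<^sub>v p 1 \<in> vspan N (C (Suc ?m))"
    using pow_mat_Suc_mult_vec[OF K p1, of ?m] by (simp only: A)
  with 1 show ?case by blast
qed

section \<open>Pairs lie in the span of the Krylov vectors\<close>

definition krylov_gens where
  "krylov_gens a b = (\<lambda>i. H ^\<^sub>m i *\<^sub>v p 1) ` {..<b} \<union> (\<lambda>i. K ^\<^sub>m i *\<^sub>v (K *\<^sub>v p 1)) ` {..<a}"

lemma Kp1: "K *\<^sub>v p 1 \<in> carrier_vec N"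
  by (rule mult_mat_vec_carrier[OF K p1])

lemma krylov_gens_carrier: "krylov_gens a b \<subseteq> carrier_vec N"
  using pow_mat_mult_vec_carrier[OF H p1] pow_mat_mult_vec_carrier[OF K Kp1]
  by (auto simp: krylov_gens_def)

lemma krylov_gens_mono: "a \<le> a' \<Longrightarrow> b \<le> b' \<Longrightarrow> krylov_gens a b \<subseteq> krylov_gens a' b'"
  by (auto simp: krylov_gens_def)

lemma krylov_span_mono:
  "a \<le> a' \<Longrightarrow> b \<le> b' \<Longrightarrow> s \<in> vspan N (krylov_gens a b) \<Longrightarrow> s \<in> vspan N (krylov_gens a' b')"
  using vspan_mono[OF krylov_gens_carrier krylov_gens_mono] by blast

text \<open>\<open>krylov_gens a b\<close> is the window of exponents -a, ..., b - 1 of H applied to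
  \<open>p 1\<close>, and multiplication by H shifts it up by one. The vector
  \<open>K *\<^sub>v p 1\<close> is sent to \<open>p 1\<close>, which the enlarged window contains
  even if b = 0.\<close>

lemma H_krylov:
  assumes s: "s \<in> vspan N (krylov_gens a b)"
  shows "H *\<^sub>v s \<in> vspan N (krylov_gens a (Suc b))"
proof (rule vspan_mult_mat_vec[OF krylov_gens_carrier krylov_gens_carrier H _ s])
  fix s assume "s \<in> krylov_gens a b"
  then have "H *\<^sub>v s \<in> krylov_gens a (Suc b)"
    unfolding krylov_gens_def
  proof
    assume "s \<in> (\<lambda>i. H ^\<^sub>m i *\<^sub>v p 1) ` {..<b}"
    then obtain i where "s = H ^\<^sub>m i *\<^sub>v p 1" "i < b" by auto
    then have "H *\<^sub>v s = H ^\<^sub>m Suc i *\<^sub>v p 1" "Suc i < Suc b"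
      using pow_mat_Suc_mult_vec[OF H p1, of i] by auto
    then show "H *\<^sub>v s \<in> (\<lambda>i. H ^\<^sub>m i *\<^sub>v p 1) ` {..<Suc b} \<union> (\<lambda>i. K ^\<^sub>m i *\<^sub>v (K *\<^sub>v p 1)) ` {..<a}"
      by blast
  next
    assume "s \<in> (\<lambda>i. K ^\<^sub>m i *\<^sub>v (K *\<^sub>v p 1)) ` {..<a}"
    then obtain i where s: "s = K ^\<^sub>m i *\<^sub>v (K *\<^sub>v p 1)" "i < a" by auto
    have "K ^\<^sub>m i *\<^sub>v p 1 \<in> carrier_vec N" by (rule pow_mat_mult_vec_carrier[OF K p1])
    then have Hs: "H *\<^sub>v s = K ^\<^sub>m i *\<^sub>v p 1"
      unfolding s pow_mat_mult_vec_comm[OF K p1]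
      using A_inverse[of "K ^\<^sub>m i *\<^sub>v p 1" 1 0] by (simp add: step_mat_def)
    show "H *\<^sub>v s \<in> (\<lambda>i. H ^\<^sub>m i *\<^sub>v p 1) ` {..<Suc b} \<union> (\<lambda>i. K ^\<^sub>m i *\<^sub>v (K *\<^sub>v p 1)) ` {..<a}"
    proof (cases i)
      case 0
      then have "H *\<^sub>v s = H ^\<^sub>m 0 *\<^sub>v p 1" using Hs H K by simp
      then show ?thesis by blast
    next
      case (Suc l)
      then have "H *\<^sub>v s = K ^\<^sub>m l *\<^sub>v (K *\<^sub>v p 1)"
        using Hs pow_mat_Suc_mult_vec[OF K p1, of l] pow_mat_mult_vec_comm[OF K p1, of l] by simp
      then show ?thesis using Suc s(2) by auto
    qed
  qed
  then show "H *\<^sub>v s \<in> vspan N (krylov_gens a (Suc b))"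
    by (rule vspan_base[OF krylov_gens_carrier])
qed

lemma K_krylov:
  assumes s: "s \<in> vspan N (krylov_gens a b)"
  shows "K *\<^sub>v s \<in> vspan N (krylov_gens (Suc a) b)"
proof (rule vspan_mult_mat_vec[OF krylov_gens_carrier krylov_gens_carrier K _ s])
  fix s assume "s \<in> krylov_gens a b"
  then have "K *\<^sub>v s \<in> krylov_gens (Suc a) b"
    unfolding krylov_gens_def
  proof
    assume "s \<in> (\<lambda>i. K ^\<^sub>m i *\<^sub>v (K *\<^sub>v p 1)) ` {..<a}"
    then obtain i where "s = K ^\<^sub>m i *\<^sub>v (K *\<^sub>v p 1)" "i < a" by auto
    then have "K *\<^sub>v s = K ^\<^sub>m Suc i *\<^sub>v (K *\<^sub>v p 1)" "Suc i < Suc a"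
      using pow_mat_Suc_mult_vec[OF K Kp1, of i] by auto
    then show "K *\<^sub>v s \<in> (\<lambda>i. H ^\<^sub>m i *\<^sub>v p 1) ` {..<b} \<union> (\<lambda>i. K ^\<^sub>m i *\<^sub>v (K *\<^sub>v p 1)) ` {..<Suc a}"
      by blast
  next
    assume "s \<in> (\<lambda>i. H ^\<^sub>m i *\<^sub>v p 1) ` {..<b}"
    then obtain i where s: "s = H ^\<^sub>m i *\<^sub>v p 1" "i < b" by auto
    show "K *\<^sub>v s \<in> (\<lambda>i. H ^\<^sub>m i *\<^sub>v p 1) ` {..<b} \<union> (\<lambda>i. K ^\<^sub>m i *\<^sub>v (K *\<^sub>v p 1)) ` {..<Suc a}"
    proof (cases i)
      case 0
      then have "K *\<^sub>v s = K ^\<^sub>m 0 *\<^sub>v (K *\<^sub>v p 1)" using s H K p1 Kp1 by simp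
      then show ?thesis by blast
    next
      case (Suc l)
      have "H ^\<^sub>m l *\<^sub>v p 1 \<in> carrier_vec N" by (rule pow_mat_mult_vec_carrier[OF H p1])
      then have "K *\<^sub>v s = H ^\<^sub>m l *\<^sub>v p 1"
        using A_inverse[of "H ^\<^sub>m l *\<^sub>v p 1" 0 1] pow_mat_Suc_mult_vec[OF H p1, of l] s Suc
        by (simp add: step_mat_def)
      then show ?thesis using Suc s(2) by auto
    qed
  qed
  then show "K *\<^sub>v s \<in> vspan N (krylov_gens (Suc a) b)"
    by (rule vspan_base[OF krylov_gens_carrier])
qed

lemma step_in_subspace:
  assumes m: "1 \<le> m" "m < M" and X: "X \<subseteq> carrier_vec N" and C: "C m \<subseteq> vspan N X"
    and w: "A (Suc m) *\<^sub>v st m \<in> vspan N X"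
  shows "p (Suc m) \<in> vspan N X"
proof -
  have wc: "A (Suc m) *\<^sub>v st m \<in> carrier_vec N" by (rule vspan_carrier[OF X w])
  obtain r where r: "r \<in> vspan N (C m)"
    "P m *\<^sub>v (A (Suc m) *\<^sub>v st m) = A (Suc m) *\<^sub>v st m - r"
    using P_diff[of m "A (Suc m) *\<^sub>v st m"] m wc by auto
  have "r \<in> vspan N X" using vspan_least[OF _ X _ r(1)] C C_carrier[of m] m by auto
  then have "P m *\<^sub>v (A (Suc m) *\<^sub>v st m) \<in> vspan N X" unfolding r(2) by (rule vspan_minus[OF X w])
  then show ?thesis unfolding p_Suc[OF m] by (rule vspan_smult[OF X])
qed

text \<open>Within a pair, p costs one application of the step matrix to the start vector and t,
  being parallel to the image of p, a second one. So odd pairs extend the window by two at the top,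
  even pairs by two at the bottom.\<close>

lemma C_subset_krylov:
  assumes "1 \<le> m" "m \<le> M"
  shows "C m \<subseteq> vspan N (krylov_gens (2 * (m div 2)) (2 * (Suc m div 2)))"
  using assms
proof (induction m rule: nat_induct_at_least)
  case base
  have "H ^\<^sub>m 0 *\<^sub>v p 1 \<in> vspan N (krylov_gens 0 1)"
    by (rule vspan_base[OF krylov_gens_carrier]) (auto simp: krylov_gens_def)
  then have p: "p 1 \<in> vspan N (krylov_gens 0 1)" using H p1 by simp
  have "t 1 \<in> vspan N (krylov_gens 0 (Suc 1))"
    unfolding t1 by (intro vspan_smult[OF krylov_gens_carrier] H_krylov p)
  then show ?case using krylov_span_mono[OF _ _ p, of 0 2] by (auto simp: pair_vecs_def numeral_2_eq_2)
next
  case (Suc m)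
  let ?a = "2 * (m div 2)" and ?b = "2 * (Suc m div 2)"
  have m: "1 \<le> m" "m < M" and IH: "C m \<subseteq> vspan N (krylov_gens ?a ?b)" using Suc by auto
  have st: "st m \<in> vspan N (krylov_gens ?a ?b)" using st_mem[OF m(1)] IH by blast
  note tp = t_parallelD(2)[OF t_par, of "Suc m"]
  have Cs: "C (Suc m) = insert (p (Suc m)) (insert (t (Suc m)) (C m))"
    by (auto simp: pair_vecs_def atLeastAtMostSuc_conv)
  show ?case
  proof (cases "odd m")
    case True
    have A: "A (Suc m) = K" using True by (simp add: step_mat_def)
    have div: "Suc m div 2 = Suc (m div 2)" "Suc (Suc m) div 2 = Suc m div 2" using True by presburger+
    have p: "p (Suc m) \<in> vspan N (krylov_gens (Suc ?a) ?b)"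
    proof (rule step_in_subspace[OF m krylov_gens_carrier])
      show "C m \<subseteq> vspan N (krylov_gens (Suc ?a) ?b)" using IH krylov_span_mono[of ?a "Suc ?a" ?b ?b] by auto
      show "A (Suc m) *\<^sub>v st m \<in> vspan N (krylov_gens (Suc ?a) ?b)" unfolding A by (rule K_krylov[OF st])
    qed
    have "t (Suc m) \<in> vspan N (krylov_gens (Suc (Suc ?a)) ?b)"
      using tp m vspan_smult[OF krylov_gens_carrier K_krylov[OF p]] by (simp add: A)
    then show ?thesis
      unfolding Cs div using p IH krylov_span_mono[of "Suc ?a" "Suc (Suc ?a)" ?b ?b]
        krylov_span_mono[of ?a "Suc (Suc ?a)" ?b ?b] by (auto simp: div)
  next
    case False
    have A: "A (Suc m) = H" using False by (simp add: step_mat_def)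
    have div: "Suc m div 2 = m div 2" "Suc (Suc m) div 2 = Suc (m div 2)" using False by presburger+
    have p: "p (Suc m) \<in> vspan N (krylov_gens ?a (Suc ?b))"
    proof (rule step_in_subspace[OF m krylov_gens_carrier])
      show "C m \<subseteq> vspan N (krylov_gens ?a (Suc ?b))" using IH krylov_span_mono[of ?a ?a ?b "Suc ?b"] by auto
      show "A (Suc m) *\<^sub>v st m \<in> vspan N (krylov_gens ?a (Suc ?b))" unfolding A by (rule H_krylov[OF st])
    qed
    have "t (Suc m) \<in> vspan N (krylov_gens ?a (Suc (Suc ?b)))"
      using tp m vspan_smult[OF krylov_gens_carrier H_krylov[OF p]] by (simp add: A)
    then show ?thesis
      unfolding Cs div using p IH krylov_span_mono[of ?a ?a "Suc ?b" "Suc (Suc ?b)"]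
        krylov_span_mono[of ?a ?a ?b "Suc (Suc ?b)"] by (auto simp: div)
  qed
qed

lemma span_C_eq_krylov:
  assumes k: "1 \<le> k" "M = 2 * k"
  shows "vspan N (C M) = subspace_sum (krylov N H (p 1) M) (krylov N K (K *\<^sub>v p 1) M)"
proof -
  have X: "C M \<subseteq> carrier_vec N" by (rule C_carrier) simp
  have "krylov_gens M M \<subseteq> vspan N (C M)"
  proof
    fix s assume "s \<in> krylov_gens M M"
    then consider i where "i < M" "s = H ^\<^sub>m i *\<^sub>v p 1"
      | i where "i < M" "s = K ^\<^sub>m i *\<^sub>v (K *\<^sub>v p 1)"
      by (auto simp: krylov_gens_def)
    then show "s \<in> vspan N (C M)"
    proof cases
      case 1
      have sub: "D (2 * (i div 2)) \<subseteq> C M" "C (Suc (2 * (i div 2))) \<subseteq> C M"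
        using 1(1) k by (auto simp: pair_vecs_def)
      have "2 * (i div 2) < M" using 1(1) by linarith
      note H_power_mem[OF this]
      moreover have "i = 2 * (i div 2) \<or> i = Suc (2 * (i div 2))" by presburger
      ultimately show ?thesis using vspan_mono[OF X sub(1)] vspan_mono[OF X sub(2)] 1(2) by metis
    next
      case 2
      have *: "s = K ^\<^sub>m Suc i *\<^sub>v p 1"
        using 2 pow_mat_Suc_mult_vec[OF K p1] pow_mat_mult_vec_comm[OF K p1] by simp
      \<comment> \<open>As \<open>M\<close> is even, the even-numbered pair that accounts for
        exponent i + 1 of \<open>K\<close> is still among the first \<open>M\<close> pairs.\<close>
      have lt: "Suc (2 * (i div 2)) < M" using 2(1) k(2) by presburger
      then have sub: "D (Suc (2 * (i div 2))) \<subseteq> C M" "C (Suc (Suc (2 * (i div 2)))) \<subseteq> C M"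
        by (auto simp: pair_vecs_def)
      note K_power_mem[OF lt]
      moreover have "i = 2 * (i div 2) \<or> i = Suc (2 * (i div 2))" by presburger
      ultimately show ?thesis using vspan_mono[OF X sub(1)] vspan_mono[OF X sub(2)] * by metis
    qed
  qed
  moreover have "C M \<subseteq> vspan N (krylov_gens M M)"
    using C_subset_krylov[of M] k by simp
  ultimately have "vspan N (C M) = vspan N (krylov_gens M M)"
    using vspan_least[OF X krylov_gens_carrier] vspan_least[OF krylov_gens_carrier X] by blast
  also have "\<dots> = subspace_sum (krylov N H (p 1) M) (krylov N K (K *\<^sub>v p 1) M)"
    unfolding krylov_gens_def krylov_def
    by (rule vspan_Un) (use krylov_gens_carrier[of M M] in \<open>auto simp: krylov_gens_def\<close>)
  finally show ?thesis .
qed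

end

subsection \<open>The HEKS procedure\<close>

definition interleave :: "(nat \<Rightarrow> 'a) \<Rightarrow> (nat \<Rightarrow> 'a) \<Rightarrow> nat \<Rightarrow> 'a" where
  "interleave f g i = (if odd i then f (Suc i div 2) else g (i div 2))"

lemma interleave_simps [simp]:
  "interleave f g (2 * j) = g j" "interleave f g (Suc (2 * j)) = f (Suc j)"
  by (simp_all add: interleave_def)

lemma interleave_image:
  "interleave f g ` {1..m} = f ` {1..Suc m div 2} \<union> g ` {1..m div 2}"
proof
  show "interleave f g ` {1..m} \<subseteq> f ` {1..Suc m div 2} \<union> g ` {1..m div 2}"
  proof
    fix s assume "s \<in> interleave f g ` {1..m}"
    then obtain i where i: "1 \<le> i" "i \<le> m" "s = interleave f g i" by auto
    show "s \<in> f ` {1..Suc m div 2} \<union> g ` {1..m div 2}"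
    proof (cases "odd i")
      case True
      then have "s = f (Suc i div 2)" "1 \<le> Suc i div 2" "Suc i div 2 \<le> Suc m div 2"
        using i div_le_mono[of "Suc i" "Suc m" 2] by (simp_all add: interleave_def)
      then show ?thesis by auto
    next
      case False
      then have "s = g (i div 2)" "i div 2 \<le> m div 2"
        using i div_le_mono[of i m 2] by (simp_all add: interleave_def)
      moreover have "1 \<le> i div 2" using False i(1) by presburger
      ultimately show ?thesis by auto
    qed
  qed
  show "f ` {1..Suc m div 2} \<union> g ` {1..m div 2} \<subseteq> interleave f g ` {1..m}"
  proof
    fix s assume "s \<in> f ` {1..Suc m div 2} \<union> g ` {1..m div 2}"
    then consider j where "s = f j" "1 \<le> j" "j \<le> Suc m div 2"
      | j where "s = g j" "1 \<le> j" "j \<le> m div 2" by auto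
    then show "s \<in> interleave f g ` {1..m}"
    proof cases
      case 1
      then obtain l where l: "j = Suc l" by (cases j) auto
      have "s = interleave f g (Suc (2 * l))" using 1 l by simp
      moreover have "Suc (2 * l) \<in> {1..m}" using 1(3) l by simp
      ultimately show ?thesis by blast
    next
      case 2
      have "s = interleave f g (2 * j)" using 2 by simp
      moreover have "2 * j \<in> {1..m}" using 2 by simp
      ultimately show ?thesis by blast
    qed
  qed
qed

text \<open>Position of the pair number in the column order \<open>y\<^sub>a \<dots> y\<^sub>1 u\<^sub>1 \<dots> u\<^sub>b\<close> of
  \<^const>\<open>heks_S\<close>: the pairs \<open>(u\<^sub>i, v\<^sub>i)\<close> are the odd-numbered ones, \<open>(x\<^sub>i, y\<^sub>i)\<close> the even-numbered ones.\<close>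

definition pair_index :: "nat \<Rightarrow> nat \<Rightarrow> nat" where
  "pair_index a i = (if i < a then 2 * (a - i) else Suc (2 * (i - a)))"

definition heks_cols where
  "heks_cols u v x y m = (let a = m div 2; b = (m + 1) div 2 in
     map y (rev [1..<Suc a]) @ map u [1..<Suc b] @ map x (rev [1..<Suc a]) @ map v [1..<Suc b])"

lemma heks_S_cols: "heks_S n u v x y m = mat_of_cols (2 * n) (heks_cols u v x y m)"
  by (simp add: heks_S_def heks_cols_def Let_def)

lemma half_split: "m div 2 + Suc m div 2 = (m :: nat)"
  by presburger

lemma heks_cols_length: "length (heks_cols u v x y m) = 2 * m"
  using half_split[of m] by (simp add: heks_cols_def Let_def del: upt_Suc)

lemma heks_cols_set:
  "set (heks_cols u v x y m) = pair_vecs (interleave u x) (interleave v y) m"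
proof -
  have "{1..<Suc l} = {1..l}" for l :: nat by auto
  then show ?thesis
    unfolding pair_vecs_def interleave_image heks_cols_def Let_def by (auto simp del: upt_Suc)
qed

lemma pair_index_bounds:
  assumes "i < m"
  shows "1 \<le> pair_index (m div 2) i" "pair_index (m div 2) i \<le> m"
proof -
  have "2 * (i - m div 2) < m" if "\<not> i < m div 2" using that assms by linarith
  then show "1 \<le> pair_index (m div 2) i" "pair_index (m div 2) i \<le> m"
    unfolding pair_index_def by (auto simp: Suc_le_eq)
qed

lemma pair_index_inj: "pair_index a i = pair_index a j \<longleftrightarrow> i = j"
proof
  assume eq: "pair_index a i = pair_index a j"
  have "2 * r \<noteq> Suc (2 * s)" for r s :: nat by presburger
  then show "i = j" using eq unfolding pair_index_def
    by (cases "i < a"; cases "j < a") (simp_all, metis)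
qed simp

lemma heks_cols_nth:
  assumes i: "i < 2 * m"
  defines "a \<equiv> m div 2"
  shows "heks_cols u v x y m ! i =
    (if i < m then
       (if i < a then interleave v y else interleave u x) (pair_index a i)
     else
       (if i - m < a then interleave u x else interleave v y) (pair_index a (i - m)))"
proof -
  define b where "b = Suc m div 2"
  have ab: "a + b = m" unfolding a_def b_def by (rule half_split)
  have len: "length (map f (rev [1..<Suc a]) @ map g [1..<Suc b]) = m" for f g :: "nat \<Rightarrow> 'a"
    using ab by simp
  \<comment> \<open>The arguments h and h' are arbitrary: pair numbers are even to the left of
    position a and odd from a on, so \<open>interleave\<close> reads only the other sequence. This
    covers both halves of the column list.\<close>
  have half: "(map f (rev [1..<Suc a]) @ map g [1..<Suc b]) ! i =
      (if i < a then interleave h f else interleave g h') (pair_index a i)" if "i < m"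
      for f g h h' :: "nat \<Rightarrow> 'a" and i
    using that ab
    by (auto simp: nth_append rev_nth pair_index_def Suc_diff_Suc simp del: upt_Suc)
  define L1 where "L1 = map y (rev [1..<Suc a]) @ map u [1..<Suc b]"
  define L2 where "L2 = map x (rev [1..<Suc a]) @ map v [1..<Suc b]"
  have L: "heks_cols u v x y m = L1 @ L2"
    unfolding heks_cols_def Let_def a_def b_def L1_def L2_def by simp
  have "length L1 = m" unfolding L1_def by (rule len)
  then show ?thesis
    using i half[of i y u v x, folded L1_def] half[of "i - m" x v u y, folded L2_def]
    unfolding L nth_append by (cases "i < m") simp_all
qed

lemma heks_S_carrier: "heks_S n u v x y m \<in> carrier_mat (2 * n) (2 * m)"
  unfolding heks_S_cols using heks_cols_length[of u v x y m] by (metis mat_of_cols_carrier(1))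

lemma heks_S_set_cols:
  assumes "pair_vecs (interleave u x) (interleave v y) m \<subseteq> carrier_vec (2 * n)"
  shows "set (cols (heks_S n u v x y m)) = pair_vecs (interleave u x) (interleave v y) m"
  using assms unfolding heks_S_cols heks_cols_set[symmetric] by simp

text \<open>Left of position a the pairs have even number and form value -1, but there t stands in
  the first half and p in the second; the exchange restores the value 1 that J requires.\<close>

lemma heks_S_symplectic:
  assumes car: "pair_vecs (interleave u x) (interleave v y) m \<subseteq> carrier_vec (2 * n)"
    and orth: "J_orthogonal n (interleave u x) (interleave v y) alt_sign m"
  shows "(heks_S n u v x y m)\<^sup>T * J_mat n * heks_S n u v x y m = J_mat m"
proof -
  let ?p = "interleave u x" and ?t = "interleave v y" and ?L = "heks_cols u v x y m"
  define S where "S = heks_S n u v x y m"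
  have S: "S \<in> carrier_mat (2 * n) (2 * m)" unfolding S_def by (rule heks_S_carrier)
  have ST: "S\<^sup>T \<in> carrier_mat (2 * m) (2 * n)" using S by simp
  have JS: "J_mat n * S \<in> carrier_mat (2 * n) (2 * m)" by (rule mult_carrier_mat[OF J_mat_carrier S])
  have col: "col S i = ?L ! i" if "i < 2 * m" for i
    unfolding S_def heks_S_cols using that car heks_cols_length[of u v x y m] heks_cols_set[of u v x y m]
    by (intro col_mat_of_cols) (auto dest: nth_mem)
  have entry: "(S\<^sup>T * (J_mat n * S)) $$ (i, j) = J_form n (?L ! i) (?L ! j)"
    if "i < 2 * m" "j < 2 * m" for i j
  proof -
    have "(S\<^sup>T * (J_mat n * S)) $$ (i, j) = row S\<^sup>T i \<bullet> col (J_mat n * S) j"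
      using that S by simp
    also have "\<dots> = col S i \<bullet> (J_mat n *\<^sub>v col S j)"
      using that S col_mult2[OF J_mat_carrier S that(2)] by simp
    finally show ?thesis using that by (simp add: col J_form_def)
  qed
  have vc: "?p l \<in> carrier_vec (2 * n)" "?t l \<in> carrier_vec (2 * n)" if "1 \<le> l" "l \<le> m" for l
    using car that by (auto simp: pair_vecs_def)
  have form: "J_form n (?p i) (?p j) = 0" "J_form n (?t i) (?t j) = 0"
    "J_form n (?p i) (?t j) = (if i = j then alt_sign i else 0)"
    "J_form n (?t i) (?p j) = (if i = j then - alt_sign i else 0)"
    if ij: "1 \<le> i" "i \<le> m" "1 \<le> j" "j \<le> m" for i j
  proof -
    have mem: "i \<in> {1..m}" "j \<in> {1..m}" using ij by simp_all
    show "J_form n (?p i) (?p j) = 0" "J_form n (?t i) (?t j) = 0"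
      "J_form n (?p i) (?t j) = (if i = j then alt_sign i else 0)"
      using orth[unfolded J_orthogonal_def, rule_format, OF mem] by blast+
    have "J_form n (?p j) (?t i) = (if j = i then alt_sign j else 0)"
      using orth[unfolded J_orthogonal_def, rule_format, OF mem(2,1)] by blast
    then show "J_form n (?t i) (?p j) = (if i = j then - alt_sign i else 0)"
      unfolding J_form_skew[OF vc(2)[OF ij(1,2)] vc(1)[OF ij(3,4)]] by simp
  qed
  have "S\<^sup>T * (J_mat n * S) = J_mat m"
  proof (rule eq_matI)
    fix i j assume "i < dim_row (J_mat m)" "j < dim_col (J_mat m)"
    then have ij: "i < 2 * m" "j < 2 * m" by auto
    define a where "a = m div 2"
    define i' where "i' = (if i < m then i else i - m)"
    define j' where "j' = (if j < m then j else j - m)"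
    have lt: "i' < m" "j' < m" using ij by (auto simp: i'_def j'_def)
    note b = pair_index_bounds[OF lt(1), folded a_def] pair_index_bounds[OF lt(2), folded a_def]
    have sgn: "alt_sign (pair_index a l) = (if l < a then -1 else 1)" for l
      by (simp add: alt_sign_def pair_index_def)
    \<comment> \<open>The equivalence selects t for the y columns (first half, left of a) and for
      the v columns (second half, from a on).\<close>
    have Li: "?L ! i = (if i < m \<longleftrightarrow> i' < a then ?t else ?p) (pair_index a i')"
      unfolding heks_cols_nth[OF ij(1)] a_def i'_def by simp
    have Lj: "?L ! j = (if j < m \<longleftrightarrow> j' < a then ?t else ?p) (pair_index a j')"
      unfolding heks_cols_nth[OF ij(2)] a_def j'_def by simp
    have "J_form n (?L ! i) (?L ! j) =
        (if (i < m) = (j < m) then 0 else if i' = j' then if i < m then 1 else -1 else 0)"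
      unfolding Li Lj
      by (cases "i < m"; cases "j < m"; cases "i' < a"; cases "j' < a")
        (simp_all add: form[OF b] pair_index_inj sgn)
    also have "\<dots> = J_mat m $$ (i, j)"
      unfolding J_mat_index[OF ij] i'_def j'_def by (cases "i < m"; cases "j < m") simp_all
    finally show "(S\<^sup>T * (J_mat n * S)) $$ (i, j) = J_mat m $$ (i, j)" using entry[OF ij] by simp
  qed (use S in auto)
  then show ?thesis
    using assoc_mult_mat[OF ST J_mat_carrier S] by (simp add: S_def)
qed

lemma heks_P_iff:
  assumes car: "pair_vecs (interleave u x) (interleave v y) m \<subseteq> carrier_vec (2 * n)"
    and orth: "J_orthogonal n (interleave u x) (interleave v y) alt_sign m"
    and w: "w \<in> carrier_vec (2 * n)"
  shows "J_projection n (pair_vecs (interleave u x) (interleave v y) m) w z \<longleftrightarrow>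
    heks_P n u v x y m *\<^sub>v w = z"
proof -
  note proj = symplectic_projection[OF heks_S_carrier heks_S_symplectic[OF car orth] w,
      unfolded heks_S_set_cols[OF car]]
  let ?P = "1\<^sub>m (2 * n) - heks_S n u v x y m * (J_mat m)\<^sup>T * (heks_S n u v x y m)\<^sup>T * J_mat n"
  have P: "heks_P n u v x y m = ?P" by (simp add: heks_P_def Let_def)
  show ?thesis
    unfolding J_projection_def P
  proof
    assume "z \<in> carrier_vec (2 * n) \<and>
      w - z \<in> vspan (2 * n) (pair_vecs (interleave u x) (interleave v y) m) \<and>
      (\<forall>s\<in>pair_vecs (interleave u x) (interleave v y) m. J_form n s z = 0)"
    then show "?P *\<^sub>v w = z" using proj(4) by blast
  next
    assume z: "?P *\<^sub>v w = z"
    show "z \<in> carrier_vec (2 * n) \<and>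
      w - z \<in> vspan (2 * n) (pair_vecs (interleave u x) (interleave v y) m) \<and>
      (\<forall>s\<in>pair_vecs (interleave u x) (interleave v y) m. J_form n s z = 0)"
      using proj(1-3) unfolding z by blast
  qed
qed

lemma heks_P_carrier: "heks_P n u v x y m \<in> carrier_mat (2 * n) (2 * n)"
  by (rule carrier_matI) (simp_all add: heks_P_def heks_S_def Let_def)

lemma heks_run_imp_heks:
  assumes ham: "hamiltonian_mat n H" and inv: "invertible_mat H" and k: "k \<ge> 1"
    and u1: "u1 \<in> carrier_vec (2 * n)" and run: "heks_run n H u1 u v x y (2 * k)"
    and zero: "x 0 = 0\<^sub>v (2 * n)" "y 0 = 0\<^sub>v (2 * n)"
  shows "heks n (2 * k) H (inv_mat H) (heks_P n u v x y) (interleave u x) (interleave v y)"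
proof -
  let ?K = "inv_mat H" and ?P = "heks_P n u v x y"
  let ?p = "interleave u x" and ?t = "interleave v y"
  have H: "H \<in> carrier_mat (2 * n) (2 * n)" using ham by (simp add: hamiltonian_mat_def)
  note K = inv_mat_carrier_inverse[OF H inv]
  note R = run[unfolded heks_run_def Let_def]
  have k2: "1 \<le> 2 * k" using k by simp
  have R1: "u 1 = u1" "J_form n (u 1) (H *\<^sub>v u 1) \<noteq> 0"
    "v 1 = (1 / J_form n (u 1) (H *\<^sub>v u 1)) \<cdot>\<^sub>v (H *\<^sub>v u 1)"
    using R[THEN conjunct1, rule_format, OF k2] by blast+
  note R2 = R[THEN conjunct2, THEN conjunct1, rule_format]
  note R3 = R[THEN conjunct2, THEN conjunct2, THEN conjunct1, rule_format]
  note R4 = R[THEN conjunct2, THEN conjunct2, THEN conjunct2, rule_format]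
  have P_vec: "?P m *\<^sub>v a \<in> carrier_vec (2 * n)" for m a
    using heks_P_carrier[of n u v x y m] by (intro carrier_vecI) simp
  \<comment> \<open>Translates the divisor of y in the procedure into the locale's order of
    arguments, at the price of a sign.\<close>
  have flip: "J_form n a b \<noteq> 0 \<and> 1 / J_form n b a = -1 / J_form n a b"
    if "J_form n b a \<noteq> 0" "a \<in> carrier_vec (2 * n)" "b \<in> carrier_vec (2 * n)" for a b
    using that J_form_skew[OF that(2,3)] by simp
  define step where "step m \<longleftrightarrow>
      (let wp = ?P m *\<^sub>v (step_mat H ?K (Suc m) *\<^sub>v step_start ?p ?t m);
           wt = ?P m *\<^sub>v (step_mat H ?K (Suc m) *\<^sub>v ?p (Suc m))
       in norm2 wp \<noteq> 0 \<and> ?p (Suc m) = (1 / norm2 wp) \<cdot>\<^sub>v wp \<and>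
          J_form n (?p (Suc m)) wt \<noteq> 0 \<and>
          ?t (Suc m) = (alt_sign (Suc m) / J_form n (?p (Suc m)) wt) \<cdot>\<^sub>v wt)" for m
  \<comment> \<open>Shared by the step from u_1 to x_1 and by the later steps from y_k, which differ
    only in the start vector.\<close>
  have x_step: "step m"
    if m: "Suc m = 2 * l" and start: "step_start ?p ?t m = s"
      and nz: "norm2 (?P m *\<^sub>v (?K *\<^sub>v s)) \<noteq> 0"
      and x: "x l = (1 / norm2 (?P m *\<^sub>v (?K *\<^sub>v s))) \<cdot>\<^sub>v (?P m *\<^sub>v (?K *\<^sub>v s))"
      and nz': "J_form n (?P m *\<^sub>v (?K *\<^sub>v x l)) (x l) \<noteq> 0"
      and y: "y l = (1 / J_form n (?P m *\<^sub>v (?K *\<^sub>v x l)) (x l))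
        \<cdot>\<^sub>v (?P m *\<^sub>v (?K *\<^sub>v x l))" for m l s
  proof -
    have xc: "x l \<in> carrier_vec (2 * n)" unfolding x using P_vec by simp
    have "odd m" using m by presburger
    then have A: "step_mat H ?K (Suc m) = ?K" "alt_sign (Suc m) = -1"
      by (simp_all add: step_mat_def alt_sign_def)
    have pt: "?p (Suc m) = x l" "?t (Suc m) = y l"
      unfolding m by (rule interleave_simps)+
    note fl = flip[OF nz' xc P_vec]
    show ?thesis
      unfolding step_def Let_def A pt start
      using nz x y fl by metis
  qed
  have steps: "step m" if m: "1 \<le> m" "m < 2 * k" for m
  proof (cases "odd m")
    case False
    then obtain j where j: "m = 2 * j" by (auto elim: evenE)
    with m have j1: "1 \<le> j" "2 * j + 1 \<le> 2 * k" by auto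
    have A: "step_mat H ?K (Suc m) = H" "alt_sign (Suc m) = 1"
      using False by (simp_all add: step_mat_def alt_sign_def)
    have pt: "?p (Suc m) = u (j + 1)" "?t (Suc m) = v (j + 1)"
      unfolding j by simp_all
    have "m - 1 = Suc (2 * (j - 1))" using j j1 by simp
    then have start: "step_start ?p ?t m = v j" using j j1 by (simp add: step_start_def)
    show ?thesis
      unfolding step_def Let_def A pt start unfolding j using R3[OF j1] by blast
  next
    case True
    then obtain j where j: "m = 2 * j + 1" by (auto elim: oddE)
    show ?thesis
    proof (cases "j = 0")
      case True
      have k2: "2 \<le> 2 * k" using k by simp
      have start: "step_start ?p ?t 1 = u 1" by (simp add: step_start_def interleave_def)
      have "Suc 1 = 2 * (1 :: nat)" by simp
      from x_step[OF this start] R2[OF k2] have "step 1" by blast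
      then show ?thesis using j True by simp
    next
      case False
      then have j1: "1 \<le> j" "2 * j + 2 \<le> 2 * k" using m j by auto
      have start: "step_start ?p ?t (2 * j + 1) = y j" using j1 by (simp add: step_start_def)
      have "Suc (2 * j + 1) = 2 * (j + 1)" by simp
      from x_step[OF this start] R4[OF j1] show ?thesis unfolding j by blast
    qed
  qed
  show ?thesis
  proof
    show "?p 1 \<in> carrier_vec (2 * n)" using R1(1) u1 by (simp add: interleave_def)
    show "J_form n (?p 1) (H *\<^sub>v ?p 1) \<noteq> 0" "?t 1 = (1 / J_form n (?p 1) (H *\<^sub>v ?p 1)) \<cdot>\<^sub>v (H *\<^sub>v ?p 1)"
      using R1(2,3) by (simp_all add: interleave_def)
    show "?p 0 = 0\<^sub>v (2 * n)" "?t 0 = 0\<^sub>v (2 * n)" using zero by (simp_all add: interleave_def)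
    fix m assume m: "1 \<le> m" "m < 2 * k"
    note s = steps[OF m, unfolded step_def Let_def]
    show "norm2 (?P m *\<^sub>v (step_mat H ?K (Suc m) *\<^sub>v step_start ?p ?t m)) \<noteq> 0"
      "?p (Suc m) = (1 / norm2 (?P m *\<^sub>v (step_mat H ?K (Suc m) *\<^sub>v step_start ?p ?t m)))
        \<cdot>\<^sub>v (?P m *\<^sub>v (step_mat H ?K (Suc m) *\<^sub>v step_start ?p ?t m))"
      "J_form n (?p (Suc m)) (?P m *\<^sub>v (step_mat H ?K (Suc m) *\<^sub>v ?p (Suc m))) \<noteq> 0"
      "?t (Suc m) = (alt_sign (Suc m) / J_form n (?p (Suc m))
        (?P m *\<^sub>v (step_mat H ?K (Suc m) *\<^sub>v ?p (Suc m))))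
        \<cdot>\<^sub>v (?P m *\<^sub>v (step_mat H ?K (Suc m) *\<^sub>v ?p (Suc m)))"
      using s by blast+
  qed (fact H K ham heks_P_carrier | rule heks_P_iff, assumption+)+
qed

lemma smult_zero_vec: "(r :: real) \<cdot>\<^sub>v 0\<^sub>v N = 0\<^sub>v N"
  by (intro eq_vecI) simp_all

theorem mainTheorem2:
  fixes n k :: nat and H :: "real mat" and u1 :: "real vec"
    and u v x y :: "nat \<Rightarrow> real vec"
  assumes "hamiltonian_mat n H" and "invertible_mat H"
    and "k \<ge> 1" and "2 * k \<le> n"
    and "u1 \<in> carrier_vec (2 * n)" and "norm2 u1 = 1"
    and "subspace_dim (2 * n) (krylov (2 * n) H u1 (2 * k)) = 2 * k"
    and "subspace_dim (2 * n) (krylov (2 * n) (inv_mat H) (inv_mat H *\<^sub>v u1) (2 * k)) = 2 * k"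
    and "heks_run n H u1 u v x y (2 * k)"
    and "u 0 = 0\<^sub>v (2 * n)" and "x 0 = 0\<^sub>v (2 * n)" and "y 0 = 0\<^sub>v (2 * n)"
  shows "let S = heks_S n u v x y (2 * k);
      K = inv_mat H;
      \<theta> = (\<lambda>j. J_form n (u j) (H *\<^sub>v u j));
      f11 = J_form n (u 1) (K *\<^sub>v u 1);
      \<alpha> = (\<lambda>i. - J_form n (v i) (H *\<^sub>v v i));
      \<gamma> = (\<lambda>i. - J_form n (x i) (H *\<^sub>v v i));
      \<beta> = (\<lambda>i. if i = 1 then 0 else - J_form n (v i) (H *\<^sub>v v (i - 1)));
      \<mu> = (\<lambda>i. if i = 1 then 0 else - J_form n (x (i - 1)) (H *\<^sub>v v i));
      e = (\<lambda>i j. if i = 0 then 0 else J_form n (y j) (K *\<^sub>v y i));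
      g = (\<lambda>i j. J_form n (y i) (K *\<^sub>v u j))
    in
      S\<^sup>T * J_mat n * S = J_mat (2 * k) \<and>
      col_range S =
        subspace_sum (krylov (2 * n) H u1 (2 * k)) (krylov (2 * n) K (K *\<^sub>v u1) (2 * k)) \<and>
      (\<forall>j. 1 \<le> j \<and> j \<le> k \<longrightarrow>
         v j = (1 / \<theta> j) \<cdot>\<^sub>v (H *\<^sub>v u j) \<and>
         y j = (1 / J_form n (K *\<^sub>v x j) (x j)) \<cdot>\<^sub>v (K *\<^sub>v x j)) \<and>
      (let w = K *\<^sub>v u 1 - f11 \<cdot>\<^sub>v v 1 in x 1 = (1 / norm2 w) \<cdot>\<^sub>v w) \<and>
      (\<forall>j. 2 \<le> j \<and> j \<le> k \<longrightarrow>
         (let w = H *\<^sub>v v (j - 1) - \<gamma> (j - 1) \<cdot>\<^sub>v y (j - 1) - \<mu> (j - 1) \<cdot>\<^sub>v y (j - 2)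
                  - \<beta> (j - 1) \<cdot>\<^sub>v u (j - 2) - \<alpha> (j - 1) \<cdot>\<^sub>v u (j - 1)
          in u j = (1 / norm2 w) \<cdot>\<^sub>v w)) \<and>
      (\<forall>j. 2 \<le> j \<and> j \<le> k \<longrightarrow>
         (let w = K *\<^sub>v y (j - 1) - e (j - 1) (j - 1) \<cdot>\<^sub>v x (j - 1) - e (j - 2) (j - 1) \<cdot>\<^sub>v x (j - 2)
                  - g (j - 1) (j - 1) \<cdot>\<^sub>v v (j - 1) - g (j - 1) j \<cdot>\<^sub>v v j
          in x j = (1 / norm2 w) \<cdot>\<^sub>v w))"
proof -
  let ?p = "interleave u x" and ?t = "interleave v y" and ?K = "inv_mat H"
    and ?P = "heks_P n u v x y" and ?S = "heks_S n u v x y (2 * k)"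
  interpret heks n "2 * k" H ?K ?P ?p ?t
    by (rule heks_run_imp_heks) (fact assms)+
  have k: "1 \<le> 2 * k" "1 < 2 * k" using assms(3) by simp_all
  have A_odd: "A (Suc (2 * i)) = H" and A_even: "A (2 * i) = ?K" for i
    by (simp_all add: step_mat_def)
  have p_1: "?p 1 = u 1" "?t 1 = v 1" by (simp_all add: interleave_def)
  have u1: "u 1 = u1"
    using assms(9)[unfolded heks_run_def Let_def, THEN conjunct1, rule_format, OF k(1)] by blast
  have u_car: "u i \<in> carrier_vec N" "v i \<in> carrier_vec N" if "1 \<le> i" "i \<le> k" for i
    using pt_carrier[of "Suc (2 * (i - 1))"] that by simp_all
  have x_car: "x i \<in> carrier_vec N" "y i \<in> carrier_vec N" if "i \<le> k" for i
    using pt_carrier[of "2 * i"] that by simp_all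
  have car: "C (2 * k) \<subseteq> carrier_vec N" and orth: "J_orthogonal n ?p ?t alt_sign (2 * k)"
    using carrier_J_orthogonal[of "2 * k"] k by auto
  have symp: "?S\<^sup>T * J_mat n * ?S = J_mat (2 * k)"
    by (rule heks_S_symplectic[OF car orth])
  have range: "col_range ?S =
      subspace_sum (krylov N H u1 (2 * k)) (krylov N ?K (?K *\<^sub>v u1) (2 * k))"
    using span_C_eq_krylov[of k] assms(3) heks_S_set_cols[OF car] carrier_matD(1)[OF heks_S_carrier]
    unfolding col_range_def p_1 u1 by simp
  have v_form: "v j = (1 / \<omega> (u j) (H *\<^sub>v u j)) \<cdot>\<^sub>v (H *\<^sub>v u j)" if j: "1 \<le> j" "j \<le> k" for j
  proof -
    have "Suc (2 * (j - 1)) \<le> 2 * k" "Suc (j - 1) = j" using j by simp_all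
    from t_parallelD(2)[OF t_par[OF _ this(1)] this(1)] this(2) show ?thesis
      by (simp add: c_def A_odd alt_sign_def)
  qed
  \<comment> \<open>The sign -1 of the even pair number is cancelled by exchanging the arguments of
    the form in the divisor.\<close>
  have y_form: "y j = (1 / \<omega> (?K *\<^sub>v x j) (x j)) \<cdot>\<^sub>v (?K *\<^sub>v x j)" if j: "1 \<le> j" "j \<le> k" for j
  proof -
    have Kx: "?K *\<^sub>v x j \<in> carrier_vec N" using x_car(1)[OF j(2)] by (rule mult_mat_vec_carrier[OF K])
    have "1 \<le> 2 * j" "2 * j \<le> 2 * k" using j by simp_all
    from t_parallelD(2)[OF t_par[OF this] this(2)] show ?thesis
      unfolding J_form_skew[OF Kx x_car(1)[OF j(2)]] by (simp add: c_def A_even alt_sign_def)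
  qed
  have x1_form: "x 1 = (1 / norm2 w) \<cdot>\<^sub>v w" if w: "w = ?K *\<^sub>v u 1 - \<omega> (u 1) (?K *\<^sub>v u 1) \<cdot>\<^sub>v v 1" for w
  proof -
    have A2: "A 2 = ?K" "A (Suc 1) = ?K" by (simp_all add: step_mat_def)
    have st: "st 1 = u 1" by (simp add: step_start_def interleave_def)
    have "?P 1 *\<^sub>v (?K *\<^sub>v u 1) = w"
      using first_step[OF k(2)] unfolding w p_1 A2 .
    moreover have "?p (Suc 1) = x 1" by (simp add: interleave_def)
    ultimately show ?thesis
      using p_Suc[OF le_refl k(2), unfolded A2 st] by simp
  qed
  have u_form: "u (Suc i) = (1 / norm2 w) \<cdot>\<^sub>v w"
    if i: "1 \<le> i" "Suc i \<le> k" and w: "w = H *\<^sub>v v i - (- \<omega> (x i) (H *\<^sub>v v i)) \<cdot>\<^sub>v y i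
      - (if i = 1 then 0 else - \<omega> (x (i - 1)) (H *\<^sub>v v i)) \<cdot>\<^sub>v y (i - 1)
      - (if i = 1 then 0 else - \<omega> (v i) (H *\<^sub>v v (i - 1))) \<cdot>\<^sub>v u (i - 1)
      - (- \<omega> (v i) (H *\<^sub>v v i)) \<cdot>\<^sub>v u i" for i w
  proof -
    have m: "2 \<le> 2 * i" "2 * i < 2 * k" using i by simp_all
    have idx: "2 * i - 1 = Suc (2 * (i - 1))" "2 * i - 2 = 2 * (i - 1)" using i by simp_all
    have idx3: "2 * i - 3 = (if i = 1 then 0 else Suc (2 * (i - 2)))" using i by auto
    have sgn: "alt_sign (2 * i) = -1" by (simp add: alt_sign_def)
    have vals: "?p (2 * i) = x i" "?t (2 * i) = y i" "?p (2 * i - 1) = u i" "?t (2 * i - 1) = v i"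
      "?p (2 * i - 2) = x (i - 1)" "?t (2 * i - 2) = y (i - 1)"
      using i unfolding idx by simp_all
    have mu: "(- 1 * \<omega> (x (i - 1)) (H *\<^sub>v v i)) \<cdot>\<^sub>v y (i - 1) =
        (if i = 1 then 0 else - \<omega> (x (i - 1)) (H *\<^sub>v v i)) \<cdot>\<^sub>v y (i - 1)"
      using assms(12) by (simp add: smult_zero_vec)
    \<comment> \<open>For i = 1 the truncated index 2i - 3 is 0, which names x_0 rather than u_0;
      both sides then vanish because x_0 and u_0 are zero. Otherwise the symmetry of the form of a
      with H b exchanges v_{i-1} and v_i.\<close>
    have beta: "(- 1 * \<omega> (?t (2 * i - 3)) (H *\<^sub>v v i)) \<cdot>\<^sub>v ?p (2 * i - 3) =
        (if i = 1 then 0 else - \<omega> (v i) (H *\<^sub>v v (i - 1))) \<cdot>\<^sub>v u (i - 1)"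
    proof (cases "i = 1")
      case True
      then show ?thesis using assms(10,11) by (simp add: idx3 interleave_def smult_zero_vec)
    next
      case False
      then have "Suc (i - 2) = i - 1" using i by simp
      moreover have "\<omega> (v (i - 1)) (H *\<^sub>v v i) = \<omega> (v i) (H *\<^sub>v v (i - 1))"
        using A_symmetric[of "v (i - 1)" "v i" 1] u_car(2)[of i] u_car(2)[of "i - 1"] False i
        by (simp add: step_mat_def)
      ultimately show ?thesis using False by (simp add: idx3)
    qed
    have "?P (2 * i) *\<^sub>v (H *\<^sub>v v i) = w"
      using short_recurrence[OF m, unfolded A_odd vals sgn, unfolded mu beta]
      unfolding w by simp
    moreover have "step_start ?p ?t (2 * i) = v i" using vals i by (simp add: step_start_def)
    ultimately show ?thesis using p_Suc[of "2 * i"] m by (simp add: A_odd)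
  qed
  have x_form: "x (Suc i) = (1 / norm2 w) \<cdot>\<^sub>v w"
    if i: "1 \<le> i" "Suc i \<le> k" and w: "w = ?K *\<^sub>v y i
      - (if i = 0 then 0 else \<omega> (y i) (?K *\<^sub>v y i)) \<cdot>\<^sub>v x i
      - (if i - 1 = 0 then 0 else \<omega> (y i) (?K *\<^sub>v y (i - 1))) \<cdot>\<^sub>v x (i - 1)
      - \<omega> (y i) (?K *\<^sub>v u i) \<cdot>\<^sub>v v i - \<omega> (y i) (?K *\<^sub>v u (Suc i)) \<cdot>\<^sub>v v (Suc i)" for i w
  proof -
    let ?m = "Suc (2 * i)"
    have m: "2 \<le> ?m" "?m < 2 * k" using i by simp_all
    have A: "A (Suc ?m) = ?K" by (simp add: step_mat_def)
    have idx: "?m - 1 = 2 * i" "?m - 2 = Suc (2 * (i - 1))" "?m - 3 = 2 * (i - 1)" using i by simp_all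
    have sgn: "alt_sign ?m = 1" by (simp add: alt_sign_def)
    have vals: "?p ?m = u (Suc i)" "?t ?m = v (Suc i)" "?p (?m - 1) = x i" "?t (?m - 1) = y i"
      "?p (?m - 2) = u i" "?t (?m - 2) = v i" "?p (?m - 3) = x (i - 1)" "?t (?m - 3) = y (i - 1)"
      using i unfolding idx by simp_all
    have cars: "u i \<in> carrier_vec N" "v i \<in> carrier_vec N" "u (Suc i) \<in> carrier_vec N"
      "v (Suc i) \<in> carrier_vec N" "x i \<in> carrier_vec N" "y i \<in> carrier_vec N"
      "x (i - 1) \<in> carrier_vec N" "y (i - 1) \<in> carrier_vec N"
      using u_car[of i] u_car[of "Suc i"] x_car[of i] x_car[of "i - 1"] i by simp_all
    have sym: "\<omega> b (?K *\<^sub>v y i) = \<omega> (y i) (?K *\<^sub>v b)" if "b \<in> carrier_vec N" for b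
      using A_symmetric[OF that, of "y i" 0] cars i by (simp add: step_mat_def)
    have Ky: "?K *\<^sub>v y i \<in> carrier_vec N" using cars i by (intro mult_mat_vec_carrier[OF K]) simp
    have last: "\<omega> (y i) (?K *\<^sub>v y (i - 1)) \<cdot>\<^sub>v x (i - 1) =
        (if i - 1 = 0 then 0 else \<omega> (y i) (?K *\<^sub>v y (i - 1))) \<cdot>\<^sub>v x (i - 1)"
      using assms(11) by (simp add: smult_zero_vec)
    have "?P ?m *\<^sub>v (?K *\<^sub>v y i) = ?K *\<^sub>v y i - \<omega> (y i) (?K *\<^sub>v u (Suc i)) \<cdot>\<^sub>v v (Suc i)
        - \<omega> (y i) (?K *\<^sub>v u i) \<cdot>\<^sub>v v i - \<omega> (y i) (?K *\<^sub>v y (i - 1)) \<cdot>\<^sub>v x (i - 1)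
        - \<omega> (y i) (?K *\<^sub>v y i) \<cdot>\<^sub>v x i"
      using short_recurrence[OF m, unfolded A vals sgn sym[OF cars(1)] sym[OF cars(3)]
          sym[OF cars(8)]] by simp
    \<comment> \<open>The general recurrence subtracts the four terms in the reverse order of the
      theorem.\<close>
    also have "\<dots> = w"
      unfolding w last[symmetric] using cars i Ky by (intro eq_vecI) auto
    finally have "?P ?m *\<^sub>v (?K *\<^sub>v y i) = w" .
    moreover have "step_start ?p ?t ?m = y i" using i by (simp add: step_start_def)
    moreover have "?p (Suc ?m) = x (Suc i)" using interleave_simps(1)[of u x "Suc i"] by simp
    ultimately show ?thesis using p_Suc[of ?m] m by (simp add: A)
  qed
  have idx: "j = Suc (j - 1)" "1 \<le> j - 1" "Suc (j - 1) \<le> k" "j - 2 = j - 1 - 1"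
    if "2 \<le> j \<and> j \<le> k" for j
    using that by arith+
  \<comment> \<open>Both j - 2 and j - 1 - 1 occur because the indices are kept exactly as the
    definitions in the theorem unfold, so that the closing \<open>refl\<close> matches.\<close>
  have u_rec: "u j = (1 / norm2 w) \<cdot>\<^sub>v w"
    if j: "2 \<le> j \<and> j \<le> k"
      and w: "w = H *\<^sub>v v (j - 1) - (- \<omega> (x (j - 1)) (H *\<^sub>v v (j - 1))) \<cdot>\<^sub>v y (j - 1)
        - (if j - 1 = 1 then 0 else - \<omega> (x (j - 1 - 1)) (H *\<^sub>v v (j - 1))) \<cdot>\<^sub>v y (j - 2)
        - (if j - 1 = 1 then 0 else - \<omega> (v (j - 1)) (H *\<^sub>v v (j - 1 - 1))) \<cdot>\<^sub>v u (j - 2)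
        - (- \<omega> (v (j - 1)) (H *\<^sub>v v (j - 1))) \<cdot>\<^sub>v u (j - 1)" for j w
    by (subst idx(1)[OF j], rule u_form[OF idx(2,3)[OF j]]) (rule w[unfolded idx(4)[OF j]])
  have x_rec: "x j = (1 / norm2 w) \<cdot>\<^sub>v w"
    if j: "2 \<le> j \<and> j \<le> k"
      and w: "w = ?K *\<^sub>v y (j - 1)
        - (if j - 1 = 0 then 0 else \<omega> (y (j - 1)) (?K *\<^sub>v y (j - 1))) \<cdot>\<^sub>v x (j - 1)
        - (if j - 2 = 0 then 0 else \<omega> (y (j - 1)) (?K *\<^sub>v y (j - 2))) \<cdot>\<^sub>v x (j - 2)
        - \<omega> (y (j - 1)) (?K *\<^sub>v u (j - 1)) \<cdot>\<^sub>v v (j - 1)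
        - \<omega> (y (j - 1)) (?K *\<^sub>v u j) \<cdot>\<^sub>v v j" for j w
  proof -
    have "Suc (j - 1) = j" using j by simp
    note x_form[OF idx(2,3)[OF j], unfolded this]
    then show ?thesis using w unfolding idx(4)[OF j] by blast
  qed
  show ?thesis
    unfolding Let_def
  proof (intro conjI allI impI)
    show "?S\<^sup>T * J_mat n * ?S = J_mat (2 * k)" by (rule symp)
    show "col_range ?S = subspace_sum (krylov N H u1 (2 * k)) (krylov N ?K (?K *\<^sub>v u1) (2 * k))"
      by (rule range)
  next
    fix j assume "1 \<le> j \<and> j \<le> k"
    then have j: "1 \<le> j" "j \<le> k" by simp_all
    show "v j = (1 / \<omega> (u j) (H *\<^sub>v u j)) \<cdot>\<^sub>v (H *\<^sub>v u j)" by (rule v_form[OF j])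
    show "y j = (1 / \<omega> (?K *\<^sub>v x j) (x j)) \<cdot>\<^sub>v (?K *\<^sub>v x j)" by (rule y_form[OF j])
  next
    show "x 1 = (1 / norm2 (?K *\<^sub>v u 1 - \<omega> (u 1) (?K *\<^sub>v u 1) \<cdot>\<^sub>v v 1)) \<cdot>\<^sub>v
        (?K *\<^sub>v u 1 - \<omega> (u 1) (?K *\<^sub>v u 1) \<cdot>\<^sub>v v 1)"
      by (rule x1_form[OF refl])
  qed (rule u_rec x_rec, assumption, rule refl)+
qed

end
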